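(* Let $\lambda$ be an admissible probability measure on $\mathcal X$. Let $\mathcal A_1,\dots,\mathcal A_r\subset\mathbb R^k$ be bounded Borel sets with $\mathrm{vol}_{\mathbb R^k}(\partial\mathcal A_i)=0$, let $\mathcal D_1,\dots,\mathcal D_r\subset\Sigma(\mathcal W,1)$ be Borel sets each having compact closure in $HQ$ and satisfying $\nu(\partial\mathcal D_i)=0$ (boundary taken in $HQ$), and let $N\in\mathbb Z_{\ge0}^r$. Then $$\lim_{L\to\infty}\lambda\big(\{x:\#\{j:L^{-n/k}\xi_j(x,L)\in\mathcal A_i,\ \omega_j(x,L)\in\mathcal D_i\}=N_i\ \forall i\}\big)=\Psi^{(r)}_N(\mathcal A,\mathcal D),$$ where $$\Psi^{(r)}_N(\mathcal A,\mathcal D)=\mu\big(\{x:\#\{j:\xi_j(x,1)\in\mathcal A_i,\ \omega_j(x,1)\in\mathcal D_i\}=N_i\ \forall i\}\big)=\mu\big(\{\Gamma g:\#\{\gamma\in\Gamma:\gamma g\in\mathcal D_iU(-\mathcal A_i)\}=N_i\ \forall i\}\big),$$ with $\mathcal D_iU(-\mathcal A_i)=\{dU(-a):d\in\mathcal D_i,a\in\mathcal A_i\}$.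
   Context: Fix integers $k\ge1$, $m\ge0$, $n=k+m+1$; $G=\mathrm{SL}(n,\mathbb R)$, $\Gamma=\mathrm{SL}(n,\mathbb Z)$, $\mathcal X=\Gamma\backslash G$, $\mu$ the right-$G$-invariant probability measure on $\mathcal X$. Row vectors $y=(y',y'',y_n)\in\mathbb R^k\times\mathbb R^m\times\mathbb R$, right action. $U(s)=\begin{pmatrix}1_k&0&0\\0&1_m&0\\-s&0&1\end{pmatrix}$ ($s\in\mathbb R^k$, middle block absent if $m=0$), $h_s(x)=xU(s)$; $\Phi(t)=\mathrm{diag}(e^{(m+1)t}1_k,e^{-kt}1_m,e^{-kt})$, $\varphi_t(x)=x\Phi(t)$. A Borel probability measure $\lambda$ on $\mathcal X$ is admissible if $\lim_{t\to\infty}\lambda(\varphi_tE)=\mu(E)$ for every Borel $E$ with $\mu(\partial E)=0$. Fix a norm $|\cdot|$ on $\mathbb R^k$. Let $H=\{g\in G:(0,\dots,0,1)g=(0,\dots,0,1)\}=\{\begin{pmatrix}A&{}^tb\\0&1\end{pmatrix}:A\in\mathrm{SL}(n-1,\mathbb R),b\in\mathbb R^{n-1}\}$, $\Gamma_H=\Gamma\cap H$, and fix a Borel fundamental domain $\mathcal F_H\subset H$ for the left action of $\Gamma_H$. For $w=(w',w_{m+1})\in\mathbb R^m\times\mathbb R_{>0}$ let $R(w)=\begin{pmatrix}w_{m+1}^{-(m+1)/k}1_k&0&0\\0&w_{m+1}1_m&0\\0&w'&w_{m+1}\end{pmatrix}$, $Q=\{R(w)\}$. Each $a\in HQ$ is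 uniquely $a=\begin{pmatrix}A&{}^tb\\0&1\end{pmatrix}R(w)$; the measure $\nu$ on $HQ$ is $d\nu(a)=\zeta(n)^{-1}d\mu_0(A)\,db\,w_{m+1}^kdw$, with $\mu_0$ the Haar measure on $\mathrm{SL}(n-1,\mathbb R)$ giving $\mathrm{SL}(n-1,\mathbb Z)\backslash\mathrm{SL}(n-1,\mathbb R)$ measure 1. Let $\mathcal W\subset\mathbb R^m\times\mathbb R_{>0}$ be bounded Borel with non-empty interior and Lebesgue-null boundary; $\Sigma(\mathcal W,1)=\mathcal F_H\{R(w):w\in\mathcal W\}\subset G$; for $L>0$, $\pi_L:\Sigma(\mathcal W,1)\to\mathcal X$, $\pi_L(g)=\Gamma g\Phi(k^{-1}\log L)$, whose image is the section $\mathcal H(\mathcal W,L)=\Gamma\backslash\Gamma H\{R(w):w\in L^{-1}\mathcal W\}$. Hitting times $\xi_j(x,L)\in\mathbb R^k$ are the $s$ with $h_s(x)\in\mathcal H(\mathcal W,L)$, each listed $\#\pi_L^{-1}(\{h_s(x)\})$ times, ordered with $|\xi_1|\le|\xi_2|\le\cdots$ (equivalently, for $x=\Gamma g$, the multiset $\{v'/v_n:v\in\widehat{\mathbb Z}^ng,(v'',v_n)\in L^{-1}\mathcal W\}$, $\widehat{\mathbb Z}^n$ the primitive integer vectors). Impact parameters $\omega_j(x,L)\in\pi_L^{-1}(\{h_{\xi_j(x,L)}(x)\})$ are chosen so that for each $s$, $j\mapsto\omega_j(x,L)$ is a bijection from $\{j:\xi_j(x,L)=s\}$ onto $\pi_L^{-1}(\{h_s(x)\})$.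 The ordering and impact parameters are chosen for $L=1$ and defined for general $L$ by $\xi_j(x,L)=L^{n/k}\xi_j(\varphi_{-k^{-1}\log L}(x),1)$, $\omega_j(x,L)=\omega_j(\varphi_{-k^{-1}\log L}(x),1)$. *)

theory Defs
  imports "HOL-Analysis.Analysis" "HOL-Probability.Probability"
begin

text \<open>Conventions.  The index set of coordinates of R^n is the finite type 'k + 'j:
  the indices Inl a (a :: 'k) are the first k coordinates (the block y'), and the indices
  Inr i (i :: 'j) are the last m+1 coordinates (y'', y_n), where the distinguished element
  e :: 'j is the last coordinate n.  Thus k = CARD('k) and m + 1 = CARD('j).
  Matrices act on row vectors from the right; group elements of G = SL(n,R) are n x n
  real matrices with determinant 1; products are matrix products.\<close>

type_synonym ('k, 'j) mat = "real ^ ('k + 'j) ^ ('k + 'j)"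

definition SLn :: "('k::finite, 'j::finite) mat set" where
  "SLn = {g. det g = 1}"

definition Gamma :: "('k::finite, 'j::finite) mat set" where
  "Gamma = {g. det g = 1 \<and> (\<forall>p q. g $ p $ q \<in> \<int>)}"

definition coset :: "('k::finite, 'j::finite) mat \<Rightarrow> ('k, 'j) mat set" where
  "coset g = {gam ** g | gam. gam \<in> Gamma}"

definition Xsp :: "('k::finite, 'j::finite) mat set set" where
  "Xsp = coset ` SLn"

definition Xact :: "('k::finite, 'j::finite) mat set \<Rightarrow> ('k, 'j) mat \<Rightarrow> ('k, 'j) mat set" where
  "Xact x g = (\<lambda>h. h ** g) ` x"

definition quot_top :: "'a topology \<Rightarrow> ('a \<Rightarrow> 'b) \<Rightarrow> 'b topology" where
  "quot_top T f = topology (\<lambda>U. U \<subseteq> f ` topspace T \<and> openin T {x \<in> topspace T. f x \<in> U})"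

lemma istopology_quot: "istopology (\<lambda>U. U \<subseteq> f ` topspace T \<and> openin T {x \<in> topspace T. f x \<in> U})"
proof -
  have 1: "{x \<in> topspace T. f x \<in> S \<inter> V} = {x \<in> topspace T. f x \<in> S} \<inter> {x \<in> topspace T. f x \<in> V}" for S V
    by auto
  have 2: "{x \<in> topspace T. f x \<in> \<Union>K} = (\<Union>U\<in>K. {x \<in> topspace T. f x \<in> U})" for K
    by auto
  show ?thesis unfolding istopology_def 1 2
    by (intro conjI allI impI) (auto intro!: openin_Union)
qed

lemma openin_quot_top:
  "openin (quot_top T f) U \<longleftrightarrow> U \<subseteq> f ` topspace T \<and> openin T {x \<in> topspace T. f x \<in> U}"
  unfolding quot_top_def by (simp only: topology_inverse'[OF istopology_quot])

definition Xtop :: "('k::finite, 'j::finite) mat set topology" where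
  "Xtop = quot_top (top_of_set SLn) coset"

definition Xborel :: "('k::finite, 'j::finite) mat set measure" where
  "Xborel = sigma Xsp (Collect (openin Xtop))"

definition Xbd :: "('k::finite, 'j::finite) mat set set \<Rightarrow> ('k, 'j) mat set set" where
  "Xbd E = Xtop frontier_of E"

definition Umat :: "'j \<Rightarrow> real ^ 'k \<Rightarrow> ('k::finite, 'j::finite) mat" where
  "Umat e s = (\<chi> p q. if p = q then 1 else
      (case (p, q) of (Inr i, Inl a) \<Rightarrow> if i = e then - (s $ a) else 0 | _ \<Rightarrow> 0))"

definition Phimat :: "'j \<Rightarrow> real \<Rightarrow> ('k::finite, 'j::finite) mat" where
  "Phimat e t = (\<chi> p q. if p = q then
      (case p of Inl a \<Rightarrow> exp (real CARD('j) * t) | Inr i \<Rightarrow> exp (- real CARD('k) * t)) else 0)"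

definition phi :: "'j \<Rightarrow> real \<Rightarrow> ('k::finite, 'j::finite) mat set \<Rightarrow> ('k, 'j) mat set" where
  "phi e t x = Xact x (Phimat e t)"

text \<open>R(w) for w = (w', w_{m+1}), where w_{m+1} = w $ e and w' = (w $ i)_{i \<noteq> e}.\<close>
definition Rmat :: "'j \<Rightarrow> real ^ 'j \<Rightarrow> ('k::finite, 'j::finite) mat" where
  "Rmat e w = (\<chi> p q. case (p, q) of
      (Inl a, Inl b) \<Rightarrow> if a = b then (w $ e) powr (- real CARD('j) / real CARD('k)) else 0
    | (Inr i, Inr j) \<Rightarrow> if i = e then w $ j else if i = j then w $ e else 0
    | _ \<Rightarrow> 0)"

definition Hgrp :: "'j \<Rightarrow> ('k::finite, 'j::finite) mat set" where
  "Hgrp e = {g \<in> SLn. (axis (Inr e) 1 :: real ^ ('k + 'j)) v* g = axis (Inr e) 1}"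

definition GammaH :: "'j \<Rightarrow> ('k::finite, 'j::finite) mat set" where
  "GammaH e = Gamma \<inter> Hgrp e"

definition Wpos :: "'j \<Rightarrow> (real ^ 'j) set" where
  "Wpos e = {w. w $ e > 0}"

definition HQ :: "'j \<Rightarrow> ('k::finite, 'j::finite) mat set" where
  "HQ e = {h ** Rmat e w | h w. h \<in> Hgrp e \<and> w \<in> Wpos e}"

definition fund_dom_H :: "'j \<Rightarrow> ('k::finite, 'j::finite) mat set \<Rightarrow> bool" where
  "fund_dom_H e F \<longleftrightarrow> F \<subseteq> Hgrp e \<and> F \<in> sets borel \<and>
     (\<forall>h \<in> Hgrp e. \<exists>!f \<in> F. \<exists>gam \<in> GammaH e. h = gam ** f)"

definition Sigma1 :: "'j \<Rightarrow> ('k::finite, 'j::finite) mat set \<Rightarrow> (real ^ 'j) set \<Rightarrow> ('k, 'j) mat set" where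
  "Sigma1 e F W = {f ** Rmat e w | f w. f \<in> F \<and> w \<in> W}"

text \<open>Haar measure on H (determined up to a positive scalar; only its null sets matter below):
  a Borel measure on H, left-invariant, finite on compact sets, positive on nonempty open sets.\<close>
definition haar_H :: "'j \<Rightarrow> ('k::finite, 'j::finite) mat measure \<Rightarrow> bool" where
  "haar_H e M \<longleftrightarrow> sets M = sets (restrict_space borel (Hgrp e)) \<and>
     (\<forall>h0 \<in> Hgrp e. \<forall>S \<in> sets M. emeasure M ((\<lambda>h. h0 ** h) ` S) = emeasure M S) \<and>
     (\<forall>K. compact K \<and> K \<subseteq> Hgrp e \<longrightarrow> emeasure M K < \<infinity>) \<and>
     (\<forall>U. openin (top_of_set (Hgrp e)) U \<and> U \<noteq> {} \<longrightarrow> emeasure M U > 0)"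

text \<open>nu-null subsets of HQ: d nu = zeta(n)^{-1} d mu_0(A) db w_{m+1}^k dw, and d mu_0(A) db is
  Haar measure of H, so S is nu-null iff its preimage under (h,w) \<mapsto> h R(w) is null for
  (Haar on H) x (Lebesgue on R^m x R_{>0}).\<close>
definition nu_null :: "'j \<Rightarrow> ('k::finite, 'j::finite) mat measure \<Rightarrow> ('k, 'j) mat set \<Rightarrow> bool" where
  "nu_null e M S \<longleftrightarrow>
     {(h, w). h \<in> Hgrp e \<and> w \<in> Wpos e \<and> h ** Rmat e w \<in> S} \<in> null_sets (M \<Otimes>\<^sub>M (lborel :: (real ^ 'j) measure))"

definition haar_X :: "('k::finite, 'j::finite) mat set measure \<Rightarrow> bool" where
  "haar_X mu \<longleftrightarrow> prob_space mu \<and> space mu = Xsp \<and> sets mu = sets Xborel \<and>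
     (\<forall>g \<in> SLn. \<forall>E \<in> sets mu. measure mu ((\<lambda>x. Xact x g) ` E) = measure mu E)"

definition admissible :: "'j \<Rightarrow> ('k::finite, 'j::finite) mat set measure \<Rightarrow> ('k, 'j) mat set measure \<Rightarrow> bool" where
  "admissible e mu lam \<longleftrightarrow> prob_space lam \<and> space lam = Xsp \<and> sets lam = sets Xborel \<and>
     (\<forall>E \<in> sets Xborel. measure mu (Xbd E) = 0 \<longrightarrow>
        ((\<lambda>t. measure lam (phi e t ` E)) \<longlongrightarrow> measure mu E) at_top)"

text \<open>The set of pairs (s, omega) with omega \<in> pi_1^{-1}(h_s(x)), s \<in> A, omega \<in> D,
  i.e. the pairs (xi_j(x,1), omega_j(x,1)) counted by #{j : xi_j(x,1) \<in> A, omega_j(x,1) \<in> D}.\<close>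
definition hits :: "'j \<Rightarrow> ('k::finite, 'j::finite) mat set \<Rightarrow> (real ^ 'j) set \<Rightarrow> ('k, 'j) mat set
     \<Rightarrow> (real ^ 'k) set \<Rightarrow> ('k, 'j) mat set \<Rightarrow> ((real ^ 'k) \<times> ('k, 'j) mat) set" where
  "hits e F W x A D = {(s, g). g \<in> Sigma1 e F W \<and> coset g = Xact x (Umat e s) \<and> s \<in> A \<and> g \<in> D}"

text \<open>#{j : L^{-n/k} xi_j(x,L) \<in> A, omega_j(x,L) \<in> D}
   = #{j : xi_j(phi_{-k^{-1} log L}(x),1) \<in> A, omega_j(phi_{-k^{-1} log L}(x),1) \<in> D}.\<close>
definition hits_L :: "'j \<Rightarrow> ('k::finite, 'j::finite) mat set \<Rightarrow> (real ^ 'j) set \<Rightarrow> real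
     \<Rightarrow> ('k, 'j) mat set \<Rightarrow> (real ^ 'k) set \<Rightarrow> ('k, 'j) mat set \<Rightarrow> ((real ^ 'k) \<times> ('k, 'j) mat) set" where
  "hits_L e F W L x A D = hits e F W (phi e (- ln L / real CARD('k)) x) A D"

end

theory Submission
  imports Defs
begin

text \<open>
  Let \<open>E\<close> be the set of \<open>x\<close> with the prescribed hit counts at \<open>L = 1\<close>. The event at scale \<open>L\<close> is
  the translate of \<open>E\<close> under \<open>\<phi>\<^sub>t\<close> with \<open>t = k\<^sup>-\<^sup>1 log L\<close>, so by admissibility it suffices
  that \<open>E\<close> is Borel and that its boundary is \<open>\<mu>\<close>-null.

  For \<open>x = \<Gamma>g\<close> the hits correspond to the \<open>\<gamma> \<in> \<Gamma>\<close> with \<open>\<gamma>g \<in> B\<^sub>i = D\<^sub>iU(-A\<^sub>i)\<close>. As \<open>\<Gamma>\<close> acts properly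
  discontinuously and \<open>B\<^sub>i\<close> is bounded, the counts are locally constant at \<open>g\<close> unless \<open>\<Gamma>g\<close> meets \<open>\<partial>B\<^sub>i\<close>,
  which is contained in \<open>(\<partial>D\<^sub>i)U \<union> cl(D\<^sub>i)U(-\<partial>A\<^sub>i)\<close>.

  Both parts have null image in \<open>\<X>\<close>, by Fubini. For the second one, average over right translations by
  \<open>U(s)\<close>. For the first one, average \<open>\<mu>\<close> over right translations by matrices normalised to determinant
  one: this reduces the claim to the Lebesgue measure of a set of matrices, and averaging that set over left
  translations by \<open>H\<close> reduces it to \<open>\<nu>(\<partial>D\<^sub>i) = 0\<close>.
\<close>

section \<open>Matrices\<close>

lemma det_diagonal_except_row:
  fixes M :: "'a::comm_ring_1 ^ 'n ^ 'n"
  assumes "\<And>p q. p \<noteq> e \<Longrightarrow> q \<noteq> p \<Longrightarrow> M $ p $ q = 0"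
  shows "det M = (\<Prod>p\<in>UNIV. M $ p $ p)"
proof -
  have "of_int (sign \<pi>) * (\<Prod>p\<in>UNIV. M $ p $ \<pi> p) = 0" if \<pi>: "\<pi> permutes UNIV" "\<pi> \<noteq> id" for \<pi>
  proof -
    obtain p where "\<pi> p \<noteq> p"
      using \<pi>(2) by (metis eq_id_iff)
    with permutes_inj[OF \<pi>(1)] obtain q where "q \<noteq> e" "\<pi> q \<noteq> q"
      by (metis injD)
    then have "M $ q $ \<pi> q = 0"
      by (rule assms)
    then have "(\<Prod>p\<in>UNIV. M $ p $ \<pi> p) = 0"
      by (metis UNIV_I finite prod_zero)
    then show ?thesis by simp
  qed
  then have "det M = (\<Sum>\<pi>\<in>{id}. of_int (sign \<pi>) * (\<Prod>p\<in>UNIV. M $ p $ \<pi> p))"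
    unfolding det_def by (intro sum.mono_neutral_right) (auto simp: permutes_id)
  then show ?thesis by simp
qed

lemma prod_UNIV_Plus:
  fixes f :: "'a::finite + 'b::finite \<Rightarrow> 'c::comm_monoid_mult"
  shows "(\<Prod>p\<in>UNIV. f p) = (\<Prod>a\<in>UNIV. f (Inl a)) * (\<Prod>b\<in>UNIV. f (Inr b))"
  by (simp flip: UNIV_Plus_UNIV add: prod.Plus)

lemma axis_vector_matrix_mult: "axis p 1 v* g = (g :: 'a::semiring_1 ^ 'n ^ 'm) $ p"
  by (simp add: vector_matrix_mult_def axis_def vec_eq_iff if_distribR
      if_distrib[of "\<lambda>x. x * _"] cong: if_cong)

lemma matrix_mult_nth: "(g ** h) $ p = (g :: 'a::comm_semiring_1 ^ 'n ^ 'm) $ p v* h"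
  by (simp flip: axis_vector_matrix_mult add: vector_matrix_mul_assoc)

lemma mat_1_nth: "(mat 1 :: 'a::semiring_1 ^ 'n ^ 'n) $ p = axis p 1"
  by (auto simp: mat_def axis_def vec_eq_iff)

lemma
  fixes A :: "'a::field ^ 'n ^ 'n"
  assumes "det A \<noteq> 0"
  shows matrix_inv_right [simp]: "A ** matrix_inv A = mat 1"
    and matrix_inv_left [simp]: "matrix_inv A ** A = mat 1"
proof -
  have "\<exists>B. A ** B = mat 1 \<and> B ** A = mat 1"
    using assms by (simp flip: invertible_det_nz add: invertible_def)
  then have "A ** matrix_inv A = mat 1 \<and> matrix_inv A ** A = mat 1"
    unfolding matrix_inv_def by (rule someI_ex)
  then show "A ** matrix_inv A = mat 1" "matrix_inv A ** A = mat 1" by auto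
qed

lemma matrix_inv_cancel [simp]:
  fixes A :: "'a::field ^ 'n ^ 'n"
  assumes "det A \<noteq> 0"
  shows "A ** (matrix_inv A ** B) = B" "matrix_inv A ** (A ** B) = B"
    "C ** A ** matrix_inv A = C" "C ** matrix_inv A ** A = C"
  using assms by (simp_all add: matrix_mul_assoc) (simp_all flip: matrix_mul_assoc)

lemma matrix_inv_unique:
  fixes A :: "'a::field ^ 'n ^ 'n"
  assumes "A ** B = mat 1"
  shows "matrix_inv A = B"
proof -
  have "det A * det B = 1"
    using assms by (metis det_I det_mul)
  then have "det A \<noteq> 0" by auto
  then show ?thesis
    using matrix_inv_cancel(2)[of A B] assms by simp
qed

lemma det_matrix_inv [simp]:
  fixes A :: "'a::field ^ 'n ^ 'n"
  assumes "det A \<noteq> 0"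
  shows "det (matrix_inv A) = inverse (det A)"
proof (rule inverse_unique[symmetric])
  show "det A * det (matrix_inv A) = 1"
    using assms by (simp flip: det_mul)
qed

lemma matrix_inv_matrix_inv [simp]:
  fixes A :: "'a::field ^ 'n ^ 'n"
  shows "det A \<noteq> 0 \<Longrightarrow> matrix_inv (matrix_inv A) = A"
  by (rule matrix_inv_unique) simp

lemma matrix_inv_mult:
  fixes A B :: "'a::field ^ 'n ^ 'n"
  assumes "det A \<noteq> 0" "det B \<noteq> 0"
  shows "matrix_inv (A ** B) = matrix_inv B ** matrix_inv A"
  using assms by (intro matrix_inv_unique) (simp add: matrix_mul_assoc)

lemma matrix_inv_cramer:
  fixes A :: "'a::field ^ 'n ^ 'n"
  assumes "det A \<noteq> 0"
  shows "matrix_inv A = (\<chi> i j. det (\<chi> p q. if q = i then axis j 1 $ p else A $ p $ q) / det A)"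
proof -
  have "A *v column j (matrix_inv A) = column j (A ** matrix_inv A)" for j
    by (simp add: matrix_vector_mult_def matrix_matrix_mult_def column_def vec_eq_iff)
  then have "A *v column j (matrix_inv A) = axis j 1" for j
    using assms by (simp add: column_def mat_def axis_def vec_eq_iff)
  then have "column j (matrix_inv A)
      = (\<chi> i. det (\<chi> p q. if q = i then axis j 1 $ p else A $ p $ q) / det A)" for j
    using cramer[OF assms] by blast
  then show ?thesis
    by (simp add: column_def vec_eq_iff)
qed

lemma continuous_on_matrix_mult [continuous_intros]:
  fixes f :: "'a::topological_space \<Rightarrow> real ^ 'n ^ 'm" and g :: "'a \<Rightarrow> real ^ 'l ^ 'n"
  assumes "continuous_on S f" "continuous_on S g"
  shows "continuous_on S (\<lambda>x. f x ** g x)"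
  unfolding matrix_matrix_mult_def by (intro continuous_intros assms)

lemma continuous_on_det [continuous_intros]:
  fixes f :: "'a::topological_space \<Rightarrow> real ^ 'n ^ 'n"
  assumes "continuous_on S f"
  shows "continuous_on S (\<lambda>x. det (f x))"
  unfolding det_def by (intro continuous_intros assms)

lemma continuous_on_matrix_inv [continuous_intros]:
  fixes f :: "'a::topological_space \<Rightarrow> real ^ 'n ^ 'n"
  assumes f: "continuous_on S f" and det: "\<forall>x\<in>S. det (f x) \<noteq> 0"
  shows "continuous_on S (\<lambda>x. matrix_inv (f x))"
proof -
  have "continuous_on S (\<lambda>x. if q = i then axis j 1 $ p else f x $ p $ q)" for i j p q
    by (cases "q = i") (simp_all add: continuous_intros f)
  then have "continuous_on S
      (\<lambda>x. \<chi> i j. det (\<chi> p q. if q = i then axis j 1 $ p else f x $ p $ q) / det (f x))"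
    using det by (intro continuous_intros f) auto
  with det show ?thesis
    by (simp add: matrix_inv_cramer cong: continuous_on_cong)
qed

lemma borel_measurable_vec_lambda:
  fixes f :: "'a \<Rightarrow> 'n::finite \<Rightarrow> 'b::euclidean_space"
  assumes "\<And>i. (\<lambda>x. f x i) \<in> borel_measurable M"
  shows "(\<lambda>x. \<chi> i. f x i) \<in> borel_measurable M"
  unfolding borel_measurable_euclidean_space[of "\<lambda>x. \<chi> i. f x i"]
  using assms by (auto simp: Basis_vec_def inner_axis)

lemma borel_measurable_vec_nth [measurable (raw)]:
  fixes f :: "'a \<Rightarrow> 'b::euclidean_space ^ 'n"
  assumes "f \<in> borel_measurable M"
  shows "(\<lambda>x. f x $ i) \<in> borel_measurable M"
  by (rule borel_measurable_continuous_on[OF _ assms]) (intro continuous_intros)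

lemma borel_measurable_matrix_mult [measurable (raw)]:
  fixes f :: "'a \<Rightarrow> real ^ 'n ^ 'm" and g :: "'a \<Rightarrow> real ^ 'l ^ 'n"
  assumes "f \<in> borel_measurable M" "g \<in> borel_measurable M"
  shows "(\<lambda>x. f x ** g x) \<in> borel_measurable M"
  using assms by (rule borel_measurable_continuous_Pair) (intro continuous_intros)

lemma borel_measurable_det [measurable (raw)]:
  fixes f :: "'a \<Rightarrow> real ^ 'n ^ 'n"
  assumes "f \<in> borel_measurable M"
  shows "(\<lambda>x. det (f x)) \<in> borel_measurable M"
  by (rule borel_measurable_continuous_on[OF _ assms]) (intro continuous_intros)

lemma borel_measurable_matrix_inv [measurable (raw)]:
  fixes f :: "'a \<Rightarrow> real ^ 'n ^ 'n"
  assumes f: "f \<in> borel_measurable M" and det: "\<And>x. x \<in> space M \<Longrightarrow> det (f x) \<noteq> 0"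
  shows "(\<lambda>x. matrix_inv (f x)) \<in> borel_measurable M"
proof (rule measurable_compose[of f _ _ matrix_inv])
  show "f \<in> measurable M (restrict_space borel {A. det A \<noteq> 0})"
    using f det by (intro measurable_restrict_space2) auto
  show "matrix_inv \<in> borel_measurable (restrict_space borel {A :: real ^ 'n ^ 'n. det A \<noteq> 0})"
    by (intro borel_measurable_continuous_on_restrict continuous_intros) auto
qed

section \<open>Measure and topology\<close>

lemma AE_commute_ex:
  assumes "sigma_finite_measure M1" "sigma_finite_measure M2"
    and P: "{z \<in> space (M1 \<Otimes>\<^sub>M M2). P (fst z) (snd z)} \<in> sets (M1 \<Otimes>\<^sub>M M2)"
    and AE: "AE x in M1. AE y in M2. P x y" and nonzero: "emeasure M2 (space M2) \<noteq> 0"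
  shows "\<exists>y\<in>space M2. AE x in M1. P x y"
proof -
  interpret pair_sigma_finite M1 M2
    using assms(1,2) by (simp add: pair_sigma_finite_def)
  have "AE y in M2. y \<in> space M2 \<and> (AE x in M1. P x y)"
    using AE by (simp flip: AE_commute[OF P])
  moreover have "ae_filter M2 \<noteq> bot"
    using nonzero by (simp add: ae_filter_eq_bot_iff)
  ultimately show ?thesis
    using eventually_happens' by blast
qed

lemma distr_eq_if_inverse_preserves_emeasure:
  assumes f: "f \<in> measurable M M" and g: "g \<in> space M \<rightarrow> space M"
    and inv: "\<And>x. x \<in> space M \<Longrightarrow> g (f x) = x" "\<And>x. x \<in> space M \<Longrightarrow> f (g x) = x"
    and emeasure: "\<And>S. S \<in> sets M \<Longrightarrow> emeasure M (g ` S) = emeasure M S"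
  shows "distr M M f = M"
proof (rule measure_eqI)
  fix S assume "S \<in> sets (distr M M f)"
  then have S: "S \<in> sets M" by simp
  have "f -` S \<inter> space M = g ` S"
  proof (intro equalityI subsetI)
    fix x assume "x \<in> f -` S \<inter> space M"
    then show "x \<in> g ` S"
      using inv(1)[of x] by (intro image_eqI[of _ _ "f x"]) auto
  next
    fix x assume "x \<in> g ` S"
    then obtain y where "y \<in> S" "x = g y" by blast
    moreover from this have "y \<in> space M"
      using sets.sets_into_space[OF S] by blast
    ultimately show "x \<in> f -` S \<inter> space M"
      using g inv(2) by auto
  qed
  then show "emeasure (distr M M f) S = emeasure M S"
    using emeasure[OF S] by (simp add: emeasure_distr[OF f S])
qed simp

lemma AE_lborel_affine:
  fixes t :: "'a::euclidean_space"
  assumes "AE x in lborel. P x" "c \<noteq> 0"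
  shows "AE x in lborel. P (t + c *\<^sub>R x)"
proof (rule AE_distrD[of "\<lambda>x. t + c *\<^sub>R x" _ borel])
  have "AE x in density (distr lborel borel (\<lambda>x. t + c *\<^sub>R x)) (\<lambda>_. \<bar>c\<bar> ^ DIM('a)). P x"
    unfolding lborel_affine[OF assms(2), symmetric] by (rule assms(1))
  then show "AE x in distr lborel borel (\<lambda>x. t + c *\<^sub>R x). P x"
    using assms(2) by (subst (asm) AE_density) (simp_all add: ennreal_zero_less_divide)
qed simp

text \<open>For almost every \<open>v\<close> the condition \<open>P (f x - v)\<close> holds for almost every \<open>x\<close>; writing \<open>v = f u\<close>
  and translating by \<open>u\<close> removes \<open>v\<close>.\<close>
lemma AE_lborel_linear_surj:
  fixes f :: "'a::euclidean_space \<Rightarrow> 'b::euclidean_space"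
  assumes f: "linear f" "surj f" and P: "AE y in lborel. P y"
  shows "AE x in lborel. P (f x)"
proof -
  obtain N where N: "\<forall>y. y \<notin> N \<longrightarrow> P y" "N \<in> null_sets lborel"
    using P by (auto elim: AE_E3)
  have [measurable]: "f \<in> borel_measurable borel"
    using f(1) by (intro borel_measurable_continuous_onI linear_continuous_on)
      (simp add: linear_conv_bounded_linear)
  have [measurable]: "N \<in> sets borel"
    using N(2) by auto
  have "\<exists>v\<in>space lborel. AE x in lborel. f x - v \<notin> N"
  proof (rule AE_commute_ex)
    show "{z \<in> space (lborel \<Otimes>\<^sub>M lborel). f (fst z) - snd z \<notin> N} \<in> sets (lborel \<Otimes>\<^sub>M lborel)"
      by measurable
    have "AE v in lborel. f x - v \<notin> N" for x
      using AE_lborel_affine[OF AE_not_in[OF N(2)], of "-1" "f x"] by simp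
    then show "AE x in lborel. AE v in lborel. f x - v \<notin> N"
      by simp
  qed (simp_all add: sigma_finite_lborel)
  then obtain v where "AE x in lborel. f x - v \<notin> N" by blast
  moreover obtain u where "v = f u"
    using f(2) by (metis surjD)
  ultimately have "AE x in lborel. f (u + x) - f u \<notin> N"
    using AE_lborel_affine[of _ 1 u] by simp
  then show ?thesis
    by (rule eventually_mono) (simp add: linear_add[OF f(1)] N(1))
qed

lemma AE_lborel_matrix_mult:
  fixes a :: "real ^ 'n ^ 'n"
  assumes "det a \<noteq> 0" "AE M in lborel. P M"
  shows "AE M in lborel. P (a ** M :: real ^ 'm ^ 'n)"
proof (rule AE_lborel_linear_surj[OF _ _ assms(2)])
  show "linear (\<lambda>M. a ** M :: real ^ 'm ^ 'n)"
    by (rule linearI) (simp_all add: matrix_add_ldistrib matrix_scalar_ac scalar_matrix_assoc)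
  show "surj (\<lambda>M. a ** M :: real ^ 'm ^ 'n)"
    by (rule surjI[of _ "\<lambda>M. matrix_inv a ** M"]) (simp add: matrix_mul_assoc assms(1))
qed

lemma measurable_finite_card_eq:
  assumes I: "countable I" and P: "\<And>i. i \<in> I \<Longrightarrow> {x \<in> space M. P i x} \<in> sets M"
  shows "{x \<in> space M. finite {i \<in> I. P i x} \<and> card {i \<in> I. P i x} = n} \<in> sets M"
proof -
  define S where "S x = to_nat_on I ` {i \<in> I. P i x}" for x
  have inj: "inj_on (to_nat_on I) {i \<in> I. P i x}" for x
    using inj_on_to_nat_on[OF I] by (rule inj_on_subset) auto
  have S_iff: "m \<in> S x \<longleftrightarrow> m \<in> to_nat_on I ` I \<and> P (from_nat_into I m) x" for m x
    using I by (auto simp: S_def)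
  have [measurable]: "{x \<in> space M. m \<in> S x} \<in> sets M" for m
  proof (cases "m \<in> to_nat_on I ` I")
    case True
    then have "from_nat_into I m \<in> I"
      using I by auto
    from P[OF this] True show ?thesis by (simp add: S_iff)
  qed (simp add: S_iff)
  have "{x \<in> space M. finite {i \<in> I. P i x} \<and> card {i \<in> I. P i x} = n}
      = {x \<in> space M. finite (S x) \<and> card (S x) = n}"
    by (simp add: S_def finite_image_iff card_image inj)
  also have "\<dots> \<in> sets M" by measurable
  finally show ?thesis .
qed

lemma notin_frontier_of_iff_locally_constant:
  assumes "x \<in> topspace T"
  shows "x \<notin> T frontier_of S \<longleftrightarrow> (\<exists>U. openin T U \<and> x \<in> U \<and> (\<forall>y\<in>U. y \<in> S \<longleftrightarrow> x \<in> S))"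
proof (cases "x \<in> S")
  case True
  then have "x \<notin> T frontier_of S \<longleftrightarrow> x \<in> T interior_of S"
    using assms closure_of_subset_Int[of T S] by (auto simp: frontier_of_def)
  with True show ?thesis
    by (auto simp: interior_of_def)
next
  case False
  then have "x \<notin> T frontier_of S \<longleftrightarrow> x \<notin> T closure_of S"
    using interior_of_subset[of T S] by (auto simp: frontier_of_def)
  with False assms show ?thesis
    by (auto simp: in_closure_of)
qed

section \<open>The special linear group and its subgroups\<close>

lemma SLn_iff [simp]: "g \<in> SLn \<longleftrightarrow> det g = 1"
  by (simp add: SLn_def)

lemma closed_SLn: "closed (SLn :: ('k::finite, 'j::finite) mat set)"
  unfolding SLn_def by (intro closed_Collect_eq continuous_intros)

lemma det_Umat [simp]: "det (Umat e s :: ('k::finite, 'j::finite) mat) = 1"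
proof -
  have "det (Umat e s :: ('k, 'j) mat) = (\<Prod>p\<in>UNIV. (Umat e s :: ('k, 'j) mat) $ p $ p)"
    by (rule det_diagonal_except_row[where e = "Inr e"]) (auto simp: Umat_def split: sum.split)
  then show ?thesis by (simp add: Umat_def)
qed

lemma det_Rmat [simp]:
  assumes "w \<in> Wpos e"
  shows "det (Rmat e w :: ('k::finite, 'j::finite) mat) = 1"
proof -
  have w: "w $ e > 0" using assms by (simp add: Wpos_def)
  have "det (Rmat e w :: ('k, 'j) mat) = (\<Prod>p\<in>UNIV. (Rmat e w :: ('k, 'j) mat) $ p $ p)"
    by (rule det_diagonal_except_row[where e = "Inr e"]) (auto simp: Rmat_def split: sum.split)
  also have "\<dots> = (w $ e powr (- real CARD('j) / real CARD('k))) ^ CARD('k) * (w $ e) ^ CARD('j)"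
    unfolding prod_UNIV_Plus by (simp add: Rmat_def cong: if_cong)
  also have "\<dots> = w $ e powr (- real CARD('j)) * w $ e powr real CARD('j)"
    using w by (simp add: powr_realpow[symmetric] powr_powr)
  also have "\<dots> = 1"
    using w by (simp flip: powr_add)
  finally show ?thesis .
qed

lemma det_Phimat [simp]: "det (Phimat e t :: ('k::finite, 'j::finite) mat) = 1"
proof -
  have "det (Phimat e t :: ('k, 'j) mat) = (\<Prod>p\<in>UNIV. (Phimat e t :: ('k, 'j) mat) $ p $ p)"
    by (rule det_diagonal) (simp add: Phimat_def)
  also have "\<dots> = 1"
    unfolding prod_UNIV_Plus by (simp add: Phimat_def flip: exp_of_nat_mult exp_add)
  finally show ?thesis .
qed

lemma Phimat_mult_minus: "Phimat e t ** Phimat e (- t) = (mat 1 :: ('k::finite, 'j::finite) mat)"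
proof -
  have "(Phimat e t :: ('k, 'j) mat) $ p $ l * (Phimat e (- t) :: ('k, 'j) mat) $ l $ q
      = (if l = p then if p = q then 1 else 0 else 0)" for p l q
    by (auto simp: Phimat_def split: sum.split simp flip: exp_add)
  then show ?thesis
    by (simp add: matrix_matrix_mult_def mat_def vec_eq_iff)
qed

lemma
  fixes g :: "('k::finite, 'j::finite) mat"
  shows mult_Umat_Inl: "(g ** Umat e s) $ p $ Inl a = g $ p $ Inl a - g $ p $ Inr e * s $ a"
    and mult_Umat_Inr: "(g ** Umat e s) $ p $ Inr i = g $ p $ Inr i"
proof -
  have "g $ p $ l * (Umat e s :: ('k, 'j) mat) $ l $ Inl a
      = (if l = Inl a then g $ p $ l else 0) + (if l = Inr e then - g $ p $ l * s $ a else 0)" for l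
    by (auto simp: Umat_def split: sum.split)
  then show "(g ** Umat e s) $ p $ Inl a = g $ p $ Inl a - g $ p $ Inr e * s $ a"
    by (simp add: matrix_matrix_mult_def sum.distrib)
  have "g $ p $ l * (Umat e s :: ('k, 'j) mat) $ l $ Inr i = (if l = Inr i then g $ p $ l else 0)" for l
    by (auto simp: Umat_def split: sum.split)
  then show "(g ** Umat e s) $ p $ Inr i = g $ p $ Inr i"
    by (simp add: matrix_matrix_mult_def)
qed

lemma mat_Plus_eqI:
  fixes g h :: "'a ^ ('k::finite + 'j::finite) ^ 'n"
  assumes "\<And>p a. g $ p $ Inl a = h $ p $ Inl a" "\<And>p i. g $ p $ Inr i = h $ p $ Inr i"
  shows "g = h"
  unfolding vec_eq_iff using assms by (metis sum.exhaust)

lemma Umat_add: "Umat e s ** Umat e t = (Umat e (s + t) :: ('k::finite, 'j::finite) mat)"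
  by (rule mat_Plus_eqI; simp only: mult_Umat_Inl mult_Umat_Inr)
    (auto simp: Umat_def algebra_simps split: sum.split)

lemma Umat_0: "Umat e 0 = (mat 1 :: ('k::finite, 'j::finite) mat)"
  by (auto simp: Umat_def mat_def vec_eq_iff split: sum.split)

lemma Umat_cancel [simp]:
  "g ** Umat e (- s) ** Umat e s = g" "g ** Umat e s ** Umat e (- s) = g"
  by (simp_all flip: matrix_mul_assoc add: Umat_add Umat_0)

lemma continuous_on_Umat [continuous_intros]:
  fixes f :: "'a::topological_space \<Rightarrow> real ^ 'k"
  assumes "continuous_on S f"
  shows "continuous_on S (\<lambda>x. Umat e (f x) :: ('k::finite, 'j::finite) mat)"
proof -
  let ?I = "mat 1 :: ('k, 'j) mat"
  have "Umat e s = (\<chi> p q. case q of Inl a \<Rightarrow> ?I $ p $ Inl a - ?I $ p $ Inr e * s $ a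
      | Inr i \<Rightarrow> ?I $ p $ Inr i)" for s
    using mult_Umat_Inl[of ?I] mult_Umat_Inr[of ?I] by (intro mat_Plus_eqI) simp_all
  moreover have "continuous_on S (\<lambda>x. case q of Inl a \<Rightarrow> ?I $ p $ Inl a - ?I $ p $ Inr e * f x $ a
      | Inr i \<Rightarrow> ?I $ p $ Inr i)" for p q
    by (cases q) (simp_all add: assms continuous_intros)
  ultimately show ?thesis
    by (simp only: continuous_on_vec_lambda)
qed

lemma borel_measurable_Umat [measurable (raw)]:
  fixes f :: "'a \<Rightarrow> real ^ 'k"
  assumes "f \<in> borel_measurable M"
  shows "(\<lambda>x. Umat e (f x) :: ('k::finite, 'j::finite) mat) \<in> borel_measurable M"
  by (rule borel_measurable_continuous_on[OF _ assms]) (intro continuous_intros)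

lemma Hgrp_iff: "g \<in> Hgrp e \<longleftrightarrow> det g = 1 \<and> g $ Inr e = axis (Inr e) 1"
  by (simp add: Hgrp_def axis_vector_matrix_mult)

lemma det_Hgrp [simp]: "g \<in> Hgrp e \<Longrightarrow> det g = 1"
  by (simp add: Hgrp_iff)

lemma closed_Hgrp: "closed (Hgrp e :: ('k::finite, 'j::finite) mat set)"
proof -
  have "closed {g :: ('k, 'j) mat. det g = 1 \<and> g $ Inr e = axis (Inr e) 1}"
    by (intro closed_Collect_conj closed_Collect_eq continuous_intros)
  then show ?thesis
    by (simp flip: Hgrp_iff)
qed

lemma Hgrp_last_row: "h \<in> Hgrp e \<Longrightarrow> h $ Inr e = axis (Inr e) 1"
  by (simp add: Hgrp_iff)

lemma Hgrp_mult_last_row: "h \<in> Hgrp e \<Longrightarrow> (h ** g) $ Inr e = g $ Inr e"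
  by (simp add: matrix_mult_nth Hgrp_last_row axis_vector_matrix_mult)

lemma mat_1_in_Hgrp: "mat 1 \<in> Hgrp e"
  by (simp add: Hgrp_iff mat_1_nth)

lemma Hgrp_mult: "g \<in> Hgrp e \<Longrightarrow> h \<in> Hgrp e \<Longrightarrow> g ** h \<in> Hgrp e"
  by (subst Hgrp_iff) (simp add: det_mul Hgrp_mult_last_row Hgrp_last_row)

lemma Hgrp_matrix_inv:
  assumes "g \<in> Hgrp e"
  shows "matrix_inv g \<in> Hgrp e"
proof -
  have "matrix_inv g $ Inr e = (g ** matrix_inv g) $ Inr e"
    using assms by (simp only: Hgrp_mult_last_row)
  also have "\<dots> = axis (Inr e) 1"
    using assms by (simp add: mat_1_nth)
  finally show ?thesis
    using assms by (subst Hgrp_iff) simp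
qed

lemma det_Gamma [simp]: "\<gamma> \<in> Gamma \<Longrightarrow> det \<gamma> = 1"
  by (simp add: Gamma_def)

lemma Gamma_nth_Ints [simp]: "\<gamma> \<in> Gamma \<Longrightarrow> \<gamma> $ p $ q \<in> \<int>"
  unfolding Gamma_def by simp

lemma GammaI: "det \<gamma> = 1 \<Longrightarrow> (\<And>p q. \<gamma> $ p $ q \<in> \<int>) \<Longrightarrow> \<gamma> \<in> Gamma"
  unfolding Gamma_def by simp

lemma mat_1_in_Gamma: "mat 1 \<in> Gamma"
  by (rule GammaI) (simp_all add: mat_1_nth axis_def)

lemma Gamma_mult: "\<gamma> \<in> Gamma \<Longrightarrow> \<delta> \<in> Gamma \<Longrightarrow> \<gamma> ** \<delta> \<in> Gamma"
  by (rule GammaI, simp add: det_mul) (simp add: matrix_matrix_mult_def Ints_sum Ints_mult)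

lemma Gamma_matrix_inv:
  fixes \<gamma> :: "('k::finite, 'j::finite) mat"
  assumes "\<gamma> \<in> Gamma"
  shows "matrix_inv \<gamma> \<in> Gamma"
proof (rule GammaI)
  have "(\<chi> p q. if q = i then axis j 1 $ p else \<gamma> $ p $ q) $ p $ q \<in> \<int>" for i j p q
    using assms by (simp add: axis_def)
  then have "det (\<chi> p q. if q = i then axis j 1 $ p else \<gamma> $ p $ q) \<in> \<int>" for i j
    unfolding det_def by (intro Ints_sum Ints_mult Ints_prod) simp_all
  then show "matrix_inv \<gamma> $ i $ j \<in> \<int>" for i j
    using assms by (simp add: matrix_inv_cramer)
qed (use assms in simp)

lemma Gamma_eqI_dist:
  fixes \<gamma> \<delta> :: "('k::finite, 'j::finite) mat"
  assumes "\<gamma> \<in> Gamma" "\<delta> \<in> Gamma" "dist \<gamma> \<delta> < 1"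
  shows "\<gamma> = \<delta>"
proof -
  have "\<gamma> $ p $ q = \<delta> $ p $ q" for p q
  proof (rule Ints_eq_abs_less1[THEN iffD2])
    have "\<bar>(\<gamma> - \<delta>) $ p $ q\<bar> \<le> norm ((\<gamma> - \<delta>) $ p)"
      by (rule component_le_norm_cart)
    also have "\<dots> \<le> dist \<gamma> \<delta>"
      unfolding dist_norm by (rule Finite_Cartesian_Product.norm_nth_le)
    finally show "\<bar>\<gamma> $ p $ q - \<delta> $ p $ q\<bar> < 1"
      using assms(3) by simp
  qed (use assms(1,2) in simp_all)
  then show ?thesis
    by (simp add: vec_eq_iff)
qed

lemma finite_Gamma_bounded:
  fixes S :: "('k::finite, 'j::finite) mat set"
  assumes "bounded S"
  shows "finite (Gamma \<inter> S)"
proof -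
  have "uniform_discrete (Gamma :: ('k, 'j) mat set)"
    by (rule uniformI1[of 1]) (simp_all add: Gamma_eqI_dist)
  then show ?thesis
    using assms by (simp flip: uniform_discrete_finite_iff add: uniform_discrete_subset bounded_Int)
qed

lemma countable_Gamma: "countable (Gamma :: ('k::finite, 'j::finite) mat set)"
proof -
  have "Gamma = (\<Union>n. Gamma \<inter> cball (0 :: ('k, 'j) mat) (real n))"
    using real_arch_simple by fastforce
  also have "countable \<dots>"
    by (intro countable_UN countableI_type countable_finite finite_Gamma_bounded bounded_cball)
  finally show ?thesis .
qed

lemma Gamma_properly_discontinuous:
  fixes K C :: "('k::finite, 'j::finite) mat set"
  assumes "compact K" "compact C" "K \<subseteq> SLn"
  shows "finite {\<gamma> \<in> Gamma. \<exists>g\<in>K. \<gamma> ** g \<in> C}"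
proof -
  let ?S = "(\<lambda>z. fst z ** matrix_inv (snd z)) ` (C \<times> K)"
  have "\<forall>z\<in>C \<times> K. det (snd z) \<noteq> 0"
    using assms(3) by auto
  then have "compact ?S"
    by (intro compact_continuous_image compact_Times assms continuous_intros)
  then have "finite (Gamma \<inter> ?S)"
    by (intro finite_Gamma_bounded compact_imp_bounded)
  moreover have "{\<gamma> \<in> Gamma. \<exists>g\<in>K. \<gamma> ** g \<in> C} \<subseteq> Gamma \<inter> ?S"
  proof (intro subsetI)
    fix \<gamma> assume "\<gamma> \<in> {\<gamma> \<in> Gamma. \<exists>g\<in>K. \<gamma> ** g \<in> C}"
    then obtain g where "\<gamma> \<in> Gamma" "g \<in> K" "\<gamma> ** g \<in> C" by blast
    moreover from this have "\<gamma> = (\<gamma> ** g) ** matrix_inv g"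
      using assms(3) by auto
    ultimately show "\<gamma> \<in> Gamma \<inter> ?S"
      by (force intro: image_eqI[where x = "(\<gamma> ** g, g)"])
  qed
  ultimately show ?thesis by (rule rev_finite_subset)
qed

section \<open>The quotient space\<close>

lemma coset_eq_iff:
  fixes g h :: "('k::finite, 'j::finite) mat"
  shows "coset g = coset h \<longleftrightarrow> (\<exists>\<gamma>\<in>Gamma. g = \<gamma> ** h)"
proof
  assume "coset g = coset h"
  moreover have "g \<in> coset g"
    unfolding coset_def using mat_1_in_Gamma by (metis (mono_tags, lifting) matrix_mul_lid mem_Collect_eq)
  ultimately show "\<exists>\<gamma>\<in>Gamma. g = \<gamma> ** h"
    by (auto simp: coset_def)
next
  have subset: "coset (\<gamma> ** h) \<subseteq> coset h" if "\<gamma> \<in> Gamma" for \<gamma> h :: "('k, 'j) mat"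
    using that Gamma_mult[of _ \<gamma>] by (auto simp: coset_def matrix_mul_assoc)
  assume "\<exists>\<gamma>\<in>Gamma. g = \<gamma> ** h"
  then obtain \<gamma> where \<gamma>: "\<gamma> \<in> Gamma" "g = \<gamma> ** h" by blast
  then show "coset g = coset h"
    using subset[OF \<gamma>(1), of h] subset[OF Gamma_matrix_inv[OF \<gamma>(1)], of g] by simp
qed

lemma coset_image_iff: "coset g \<in> coset ` S \<longleftrightarrow> (\<exists>\<gamma>\<in>Gamma. \<gamma> ** g \<in> S)"
  unfolding image_iff using coset_eq_iff by metis

lemma coset_in_Xsp: "det g = 1 \<Longrightarrow> coset g \<in> Xsp"
  by (auto simp: Xsp_def)

lemma XspE:
  assumes "x \<in> Xsp"
  obtains g where "det g = 1" "x = coset g"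
  using assms by (auto simp: Xsp_def)

lemma Xact_coset [simp]: "Xact (coset g) h = coset (g ** h)"
  by (auto simp: Xact_def coset_def image_iff matrix_mul_assoc)

lemma Xact_in_Xsp: "x \<in> Xsp \<Longrightarrow> det g = 1 \<Longrightarrow> Xact x g \<in> Xsp"
  by (auto simp: det_mul coset_in_Xsp elim: XspE)

lemma Xact_Xact: "x \<in> Xsp \<Longrightarrow> Xact (Xact x g) h = Xact x (g ** h)"
  by (auto simp: matrix_mul_assoc elim: XspE)

lemma Xact_mat_1: "x \<in> Xsp \<Longrightarrow> Xact x (mat 1) = x"
  by (auto elim: XspE)

lemma topspace_Xtop [simp]: "topspace (Xtop :: ('k::finite, 'j::finite) mat set topology) = Xsp"
proof
  show "topspace (Xtop :: ('k, 'j) mat set topology) \<subseteq> Xsp"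
    using openin_topspace[of "Xtop :: ('k, 'j) mat set topology"]
    unfolding Xtop_def openin_quot_top Xsp_def by simp
  have "openin (Xtop :: ('k, 'j) mat set topology) Xsp"
    by (simp add: Xtop_def openin_quot_top Xsp_def del: SLn_iff cong: conj_cong)
  then show "Xsp \<subseteq> topspace (Xtop :: ('k, 'j) mat set topology)"
    by (rule openin_subset)
qed

lemma openin_left_mult_vimage:
  fixes V :: "('k::finite, 'j::finite) mat set"
  assumes V: "openin (top_of_set SLn) V" and "det a = 1"
  shows "openin (top_of_set SLn) (SLn \<inter> (\<lambda>g. a ** g) -` V)"
proof (rule continuous_openin_preimage[OF _ _ V])
  show "continuous_on SLn (\<lambda>g. a ** g)" by (intro continuous_intros)
  show "(**) a \<in> SLn \<rightarrow> SLn" using assms(2) by (simp add: det_mul)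
qed

lemma openin_coset_image:
  fixes V :: "('k::finite, 'j::finite) mat set"
  assumes V: "openin (top_of_set SLn) V"
  shows "openin Xtop (coset ` V)"
proof -
  have "{g \<in> SLn. coset g \<in> coset ` V} = (\<Union>\<gamma>\<in>Gamma. SLn \<inter> (\<lambda>g. \<gamma> ** g) -` V)"
    by (auto simp: coset_image_iff)
  moreover have "openin (top_of_set SLn) (\<Union>\<gamma>\<in>Gamma. SLn \<inter> (\<lambda>g. \<gamma> ** g) -` V)"
    by (intro openin_Union) (auto intro: openin_left_mult_vimage[OF V])
  ultimately show ?thesis
    using openin_imp_subset[OF V] by (auto simp: Xtop_def openin_quot_top)
qed

lemma Xborel_generators: "Collect (openin Xtop) \<subseteq> Pow Xsp"
  using openin_subset by fastforce

lemma space_Xborel [simp]: "space Xborel = Xsp"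
  by (simp add: Xborel_def Xborel_generators space_measure_of_conv)

lemma openin_Xborel: "openin Xtop U \<Longrightarrow> U \<in> sets Xborel"
  by (simp add: Xborel_def Xborel_generators sets_measure_of sigma_sets.Basic)

lemma measurable_coset:
  "(coset :: ('k::finite, 'j::finite) mat \<Rightarrow> _) \<in> measurable (restrict_space borel SLn) Xborel"
  unfolding Xborel_def
proof (rule measurable_measure_of[OF Xborel_generators])
  show "coset \<in> space (restrict_space borel SLn) \<rightarrow> Xsp"
    by (auto simp: space_restrict_space coset_in_Xsp)
  fix U :: "('k, 'j) mat set set" assume "U \<in> Collect (openin Xtop)"
  then have "openin (top_of_set SLn) {g \<in> SLn. coset g \<in> U}"
    by (simp add: Xtop_def openin_quot_top del: SLn_iff)
  then obtain V where "open V" "{g \<in> SLn. coset g \<in> U} = SLn \<inter> V"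
    unfolding openin_open by blast
  moreover have "coset -` U \<inter> space (restrict_space borel SLn) = {g \<in> SLn. coset g \<in> U}"
    by (auto simp: space_restrict_space)
  ultimately show "coset -` U \<inter> space (restrict_space borel SLn) \<in> sets (restrict_space borel SLn)"
    by (simp add: sets_restrict_space)
qed

lemma coset_locally_injective:
  fixes g :: "('k::finite, 'j::finite) mat"
  assumes "det g = 1"
  obtains V where "open V" "g \<in> V" "inj_on coset (SLn \<inter> V)"
proof -
  let ?f = "\<lambda>z. fst z ** matrix_inv (snd z) :: ('k, 'j) mat"
  have "open {z :: ('k, 'j) mat \<times> ('k, 'j) mat. det (snd z) \<noteq> 0}"
    by (intro open_Collect_neq continuous_intros)
  then have "open ({z. det (snd z) \<noteq> 0} \<inter> ?f -` ball (mat 1) 1)"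
    by (intro continuous_open_preimage continuous_intros) auto
  moreover have "(g, g) \<in> {z. det (snd z) \<noteq> 0} \<inter> ?f -` ball (mat 1) 1"
    using assms by simp
  ultimately obtain A B where AB: "open A" "open B" "g \<in> A" "g \<in> B"
      "A \<times> B \<subseteq> {z. det (snd z) \<noteq> 0} \<inter> ?f -` ball (mat 1) 1"
    by (rule open_prod_elim) auto
  have "inj_on coset (SLn \<inter> (A \<inter> B))"
  proof (rule inj_onI)
    fix a b assume a: "a \<in> SLn \<inter> (A \<inter> B)" and b: "b \<in> SLn \<inter> (A \<inter> B)" and "coset a = coset b"
    then obtain \<gamma> where \<gamma>: "\<gamma> \<in> Gamma" "a = \<gamma> ** b"
      by (auto simp: coset_eq_iff)
    have "(a, b) \<in> ?f -` ball (mat 1) 1"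
      using AB(5) a b by blast
    then have "dist (mat 1) \<gamma> < 1"
      using b \<gamma>(2) by simp
    then have "\<gamma> = mat 1"
      by (rule Gamma_eqI_dist[OF mat_1_in_Gamma \<gamma>(1), symmetric])
    then show "a = b"
      using \<gamma>(2) by simp
  qed
  then show thesis
    using AB by (intro that[of "A \<inter> B"]) auto
qed

lemma countable_cover_inj_coset:
  obtains V :: "nat \<Rightarrow> ('k::finite, 'j::finite) mat set"
  where "\<And>n. open (V n)" "\<And>n. inj_on coset (SLn \<inter> V n)" "SLn \<subseteq> (\<Union>n. V n)"
proof -
  define \<V> where "\<V> = {V :: ('k, 'j) mat set. open V \<and> inj_on coset (SLn \<inter> V)}"
  obtain \<C> where \<C>: "\<C> \<subseteq> \<V>" "countable \<C>" "\<Union>\<C> = \<Union>\<V>"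
    using Lindelof[of \<V>] by (auto simp: \<V>_def)
  have "SLn \<subseteq> \<Union>\<V>"
    unfolding \<V>_def using coset_locally_injective by fastforce
  moreover have "(mat 1 :: ('k, 'j) mat) \<in> SLn"
    by simp
  ultimately have "\<C> \<noteq> {}"
    using \<C>(3) by blast
  show thesis
  proof (rule that[of "from_nat_into \<C>"])
    show "open (from_nat_into \<C> n)" "inj_on coset (SLn \<inter> from_nat_into \<C> n)" for n
      using from_nat_into[OF \<open>\<C> \<noteq> {}\<close>, of n] \<C>(1) by (auto simp: \<V>_def)
    show "SLn \<subseteq> (\<Union>n. from_nat_into \<C> n)"
      using \<open>SLn \<subseteq> \<Union>\<V>\<close> \<C>(3) range_from_nat_into[OF \<open>\<C> \<noteq> {}\<close> \<C>(2)] by simp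
  qed
qed

lemma borel_measurable_the_inv_into_coset:
  fixes V :: "('k::finite, 'j::finite) mat set"
  assumes V: "open V" and inj: "inj_on coset (SLn \<inter> V)"
  shows "(\<lambda>x. if x \<in> coset ` (SLn \<inter> V) then the_inv_into (SLn \<inter> V) coset x else a)
    \<in> borel_measurable Xborel" (is "?\<sigma> \<in> _")
proof (rule borel_measurableI)
  have image: "coset ` (SLn \<inter> (V \<inter> S)) \<in> sets Xborel" if "open S" for S
    using V that by (intro openin_Xborel openin_coset_image openin_open_Int open_Int)
  fix S :: "('k, 'j) mat set" assume S: "open S"
  have "?\<sigma> -` S \<inter> space Xborel
      = coset ` (SLn \<inter> (V \<inter> S)) \<union> (if a \<in> S then space Xborel - coset ` (SLn \<inter> V) else {})"
    by (auto simp: the_inv_into_f_f[OF inj] coset_in_Xsp split: if_splits)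
  also have "\<dots> \<in> sets Xborel"
    using image[OF S] image[of UNIV] by (auto simp flip: space_Xborel)
  finally show "?\<sigma> -` S \<inter> space Xborel \<in> sets Xborel" .
qed

lemma measurable_section:
  obtains \<sigma> :: "('k::finite, 'j::finite) mat set \<Rightarrow> ('k, 'j) mat"
  where "\<sigma> \<in> borel_measurable Xborel" "\<And>x. x \<in> Xsp \<Longrightarrow> det (\<sigma> x) = 1 \<and> coset (\<sigma> x) = x"
proof -
  obtain V :: "nat \<Rightarrow> ('k, 'j) mat set"
    where V: "\<And>n. open (V n)" "\<And>n. inj_on coset (SLn \<inter> V n)" "SLn \<subseteq> (\<Union>n. V n)"
    using countable_cover_inj_coset by blast
  define \<sigma> where
    "\<sigma> n x = (if x \<in> coset ` (SLn \<inter> V n) then the_inv_into (SLn \<inter> V n) coset x else mat 1)" for n x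
  define N where "N x = (LEAST n. x \<in> coset ` (SLn \<inter> V n))" for x
  have [measurable]: "coset ` (SLn \<inter> V n) \<in> sets Xborel" for n
    using V(1) by (intro openin_Xborel openin_coset_image openin_open_Int)
  show thesis
  proof (rule that[of "\<lambda>x. \<sigma> (N x) x"])
    have "N \<in> measurable Xborel (count_space UNIV)"
      unfolding N_def by measurable
    then show "(\<lambda>x. \<sigma> (N x) x) \<in> borel_measurable Xborel"
      unfolding \<sigma>_def
      by (rule measurable_compose_countable[OF borel_measurable_the_inv_into_coset[OF V(1,2)]])
    fix x :: "('k, 'j) mat set" assume "x \<in> Xsp"
    then have "x \<in> coset ` (\<Union>n. SLn \<inter> V n)"
      using V(3) by (auto simp: Xsp_def)
    then obtain n where "x \<in> coset ` (SLn \<inter> V n)" by blast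
    then have "x \<in> coset ` (SLn \<inter> V (N x))"
      unfolding N_def by (rule LeastI)
    then show "det (\<sigma> (N x) x) = 1 \<and> coset (\<sigma> (N x) x) = x"
      using the_inv_into_into[OF V(2) _ subset_refl] f_the_inv_into_f[OF V(2)] by (simp add: \<sigma>_def)
  qed
qed

lemma sets_Xborel_iff:
  fixes E :: "('k::finite, 'j::finite) mat set set"
  shows "E \<in> sets Xborel \<longleftrightarrow> E \<subseteq> Xsp \<and> {g \<in> SLn. coset g \<in> E} \<in> sets borel"
proof
  assume "E \<in> sets Xborel"
  moreover from this have "{g \<in> SLn. coset g \<in> E} \<in> sets (restrict_space borel SLn)"
    using measurable_sets[OF measurable_coset, of E]
    by (simp add: space_restrict_space vimage_def Int_def conj_commute)
  ultimately show "E \<subseteq> Xsp \<and> {g \<in> SLn. coset g \<in> E} \<in> sets borel"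
    using sets.sets_into_space[of E Xborel] by (simp add: sets_restrict_space_iff closed_SLn borel_closed)
next
  assume E: "E \<subseteq> Xsp \<and> {g \<in> SLn. coset g \<in> E} \<in> sets borel"
  obtain \<sigma> :: "('k, 'j) mat set \<Rightarrow> ('k, 'j) mat"
    where \<sigma>: "\<sigma> \<in> borel_measurable Xborel" "\<And>x. x \<in> Xsp \<Longrightarrow> det (\<sigma> x) = 1 \<and> coset (\<sigma> x) = x"
    using measurable_section by blast
  have "E = \<sigma> -` {g \<in> SLn. coset g \<in> E} \<inter> space Xborel"
    using E \<sigma>(2) by auto
  also have "\<dots> \<in> sets Xborel"
    using \<sigma>(1) E by (intro measurable_sets) auto
  finally show "E \<in> sets Xborel" .
qed

lemma coset_image_Xborel:
  fixes S :: "('k::finite, 'j::finite) mat set"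
  assumes [measurable]: "S \<in> sets borel" and "S \<subseteq> SLn"
  shows "coset ` S \<in> sets Xborel"
  unfolding sets_Xborel_iff
proof
  show "coset ` S \<subseteq> Xsp"
    using assms(2) by (auto simp: Xsp_def)
  have "{g \<in> SLn. coset g \<in> coset ` S} = (\<Union>\<gamma>\<in>Gamma. {g \<in> space borel. det g = 1 \<and> \<gamma> ** g \<in> S})"
    by (auto simp: coset_image_iff)
  also have "\<dots> \<in> sets borel"
    by (intro sets.countable_UN' countable_Gamma) auto
  finally show "{g \<in> SLn. coset g \<in> coset ` S} \<in> sets borel" .
qed

lemma measurable_Xact:
  fixes g :: "'a \<Rightarrow> ('k::finite, 'j::finite) mat"
  assumes f [measurable]: "f \<in> measurable M Xborel" and g [measurable]: "g \<in> borel_measurable M"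
    and det: "\<And>x. x \<in> space M \<Longrightarrow> det (g x) = 1"
  shows "(\<lambda>x. Xact (f x) (g x)) \<in> measurable M Xborel"
proof -
  obtain \<sigma> :: "('k, 'j) mat set \<Rightarrow> ('k, 'j) mat"
    where \<sigma> [measurable]: "\<sigma> \<in> borel_measurable Xborel"
      and coset_\<sigma>: "\<And>x. x \<in> Xsp \<Longrightarrow> det (\<sigma> x) = 1 \<and> coset (\<sigma> x) = x"
    using measurable_section by blast
  have f_Xsp: "f x \<in> Xsp" if "x \<in> space M" for x
    using measurable_space[OF f that] by simp
  have "(\<lambda>x. \<sigma> (f x) ** g x) \<in> measurable M (restrict_space borel SLn)"
    using f_Xsp det coset_\<sigma> by (intro measurable_restrict_space2) (auto simp: det_mul)
  then have "(\<lambda>x. coset (\<sigma> (f x) ** g x)) \<in> measurable M Xborel"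
    by (rule measurable_compose[OF _ measurable_coset])
  moreover have "Xact (f x) (g x) = coset (\<sigma> (f x) ** g x)" if "x \<in> space M" for x
    using coset_\<sigma>[OF f_Xsp[OF that]] by (simp flip: Xact_coset)
  ultimately show ?thesis
    by (simp cong: measurable_cong)
qed

lemma phi_image:
  fixes E :: "('k::finite, 'j::finite) mat set set"
  assumes "E \<subseteq> Xsp"
  shows "phi e t ` E = {x \<in> Xsp. phi e (- t) x \<in> E}"
proof -
  have phi_minus: "phi e (- s) (phi e s x) = x" if "x \<in> Xsp" for s and x :: "('k, 'j) mat set"
    using that by (simp add: phi_def Xact_Xact Phimat_mult_minus Xact_mat_1)
  show ?thesis
  proof (intro equalityI subsetI)
    fix x assume "x \<in> phi e t ` E"
    then show "x \<in> {x \<in> Xsp. phi e (- t) x \<in> E}"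
      using assms phi_minus by (auto simp: phi_def Xact_in_Xsp)
  next
    fix x assume "x \<in> {x \<in> Xsp. phi e (- t) x \<in> E}"
    then show "x \<in> phi e t ` E"
      using phi_minus[of x "- t"] by (auto intro: image_eqI[of _ _ "phi e (- t) x"])
  qed
qed

section \<open>Flow boxes\<close>

definition w_coord :: "'j \<Rightarrow> ('k::finite, 'j::finite) mat \<Rightarrow> real ^ 'j" where
  "w_coord e g = (\<chi> i. g $ Inr e $ Inr i)"

lemma Rmat_last_row [simp]: "Rmat e w $ Inr e $ Inl a = 0" "Rmat e w $ Inr e $ Inr i = w $ i"
  by (simp_all add: Rmat_def)

lemma Hgrp_Rmat_decomp:
  fixes d :: "('k::finite, 'j::finite) mat"
  assumes "det d = 1" "\<And>a. d $ Inr e $ Inl a = 0" "d $ Inr e $ Inr e > 0"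
  shows "\<exists>h\<in>Hgrp e. d = h ** Rmat e (w_coord e d)"
proof -
  let ?R = "Rmat e (w_coord e d) :: ('k, 'j) mat"
  have "w_coord e d \<in> Wpos e"
    using assms(3) by (simp add: Wpos_def w_coord_def)
  then have det: "det ?R = 1"
    by (rule det_Rmat)
  have "d $ Inr e $ q = ?R $ Inr e $ q" for q
    using assms(2) by (cases q) (simp_all add: w_coord_def)
  then have "d $ Inr e = ?R $ Inr e"
    by (simp add: vec_eq_iff)
  then have "(d ** matrix_inv ?R) $ Inr e = axis (Inr e) 1"
    by (simp add: matrix_mult_nth) (simp flip: matrix_mult_nth add: det mat_1_nth)
  then have "d ** matrix_inv ?R \<in> Hgrp e"
    by (simp add: Hgrp_iff det_mul det assms(1))
  moreover have "d = (d ** matrix_inv ?R) ** ?R"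
    by (simp add: det)
  ultimately show ?thesis by blast
qed

lemma HQ_iff: "d \<in> HQ e \<longleftrightarrow> det d = 1 \<and> (\<forall>a. d $ Inr e $ Inl a = 0) \<and> d $ Inr e $ Inr e > 0"
proof
  assume "d \<in> HQ e"
  then show "det d = 1 \<and> (\<forall>a. d $ Inr e $ Inl a = 0) \<and> d $ Inr e $ Inr e > 0"
    by (auto simp: HQ_def det_mul Hgrp_mult_last_row Wpos_def)
next
  assume d: "det d = 1 \<and> (\<forall>a. d $ Inr e $ Inl a = 0) \<and> d $ Inr e $ Inr e > 0"
  then have "w_coord e d \<in> Wpos e"
    by (simp add: Wpos_def w_coord_def)
  then show "d \<in> HQ e"
    using d Hgrp_Rmat_decomp[of d e] by (auto simp: HQ_def)
qed

lemma Sigma1_subset_HQ: "fund_dom_H e F \<Longrightarrow> W \<subseteq> Wpos e \<Longrightarrow> Sigma1 e F W \<subseteq> HQ e"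
  by (auto simp: Sigma1_def HQ_def fund_dom_H_def)

text \<open>If the last diagonal entry of \<open>g\<close> is positive then \<open>g = d U(-s)\<close> for a unique \<open>d \<in> HQ\<close> and a
  unique \<open>s\<close>, namely \<open>d = HQ_part e g\<close> and \<open>s = s_coord e g\<close>.\<close>
definition s_coord :: "'j \<Rightarrow> ('k::finite, 'j::finite) mat \<Rightarrow> real ^ 'k" where
  "s_coord e g = (\<chi> a. g $ Inr e $ Inl a / g $ Inr e $ Inr e)"

definition HQ_part :: "'j \<Rightarrow> ('k::finite, 'j::finite) mat \<Rightarrow> ('k, 'j) mat" where
  "HQ_part e g = g ** Umat e (s_coord e g)"

lemma HQ_part_in_HQ: "det g = 1 \<Longrightarrow> g $ Inr e $ Inr e > 0 \<Longrightarrow> HQ_part e g \<in> HQ e"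
  by (simp add: HQ_iff HQ_part_def det_mul mult_Umat_Inl mult_Umat_Inr s_coord_def)

lemma HQ_part_mult_Umat: "HQ_part e g ** Umat e (- s_coord e g) = g"
  by (simp add: HQ_part_def)

lemma w_coord_HQ_part: "w_coord e (HQ_part e g) = w_coord e g"
  by (simp add: w_coord_def HQ_part_def mult_Umat_Inr)

lemma HQ_part_Hgrp_mult:
  assumes "h \<in> Hgrp e"
  shows "HQ_part e (h ** g) = h ** HQ_part e g"
  using Hgrp_mult_last_row[OF assms, of g] by (simp add: HQ_part_def s_coord_def matrix_mul_assoc)

lemma s_coord_mult_Umat:
  assumes "d $ Inr e $ Inr e > 0"
  shows "s_coord e (d ** Umat e s) = s_coord e d - s"
  using assms by (simp add: s_coord_def mult_Umat_Inl mult_Umat_Inr vec_eq_iff field_simps)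

lemma
  assumes "d \<in> HQ e"
  shows s_coord_HQ_mult_Umat: "s_coord e (d ** Umat e (- s)) = s"
    and HQ_part_HQ_mult_Umat: "HQ_part e (d ** Umat e (- s)) = d"
proof -
  have "s_coord e d = 0"
    using assms by (simp add: HQ_iff s_coord_def vec_eq_iff)
  then show s: "s_coord e (d ** Umat e (- s)) = s"
    using assms by (simp add: s_coord_mult_Umat HQ_iff)
  show "HQ_part e (d ** Umat e (- s)) = d"
    by (simp add: HQ_part_def s)
qed

lemma continuous_on_s_coord:
  "continuous_on {g. g $ Inr e $ Inr e > 0} (s_coord e :: ('k::finite, 'j::finite) mat \<Rightarrow> _)"
  unfolding s_coord_def[abs_def] by (intro continuous_intros) auto

lemma continuous_on_HQ_part:
  "continuous_on {g. g $ Inr e $ Inr e > 0} (HQ_part e :: ('k::finite, 'j::finite) mat \<Rightarrow> _)"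
  unfolding HQ_part_def[abs_def] by (intro continuous_intros continuous_on_s_coord)

lemma borel_measurable_s_coord [measurable]:
  "(s_coord e :: ('k::finite, 'j::finite) mat \<Rightarrow> _) \<in> borel_measurable borel"
  unfolding s_coord_def[abs_def] by (intro borel_measurable_vec_lambda) measurable

lemma borel_measurable_HQ_part [measurable]:
  "(HQ_part e :: ('k::finite, 'j::finite) mat \<Rightarrow> _) \<in> borel_measurable borel"
  unfolding HQ_part_def[abs_def] by measurable

definition flow_box :: "'j \<Rightarrow> ('k::finite, 'j::finite) mat set \<Rightarrow> (real ^ 'k) set \<Rightarrow> ('k, 'j) mat set" where
  "flow_box e D A = {d ** Umat e (- a) | d a. d \<in> D \<and> a \<in> A}"

lemma flow_box_iff:
  assumes "D \<subseteq> HQ e"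
  shows "g \<in> flow_box e D A \<longleftrightarrow> det g = 1 \<and> g $ Inr e $ Inr e > 0 \<and> HQ_part e g \<in> D \<and> s_coord e g \<in> A"
proof
  assume "g \<in> flow_box e D A"
  then obtain d a where da: "d \<in> D" "a \<in> A" "g = d ** Umat e (- a)"
    by (auto simp: flow_box_def)
  with assms have d: "d \<in> HQ e" by blast
  then have "det g = 1 \<and> g $ Inr e $ Inr e > 0"
    by (simp add: da(3) HQ_iff det_mul mult_Umat_Inr)
  with d show "det g = 1 \<and> g $ Inr e $ Inr e > 0 \<and> HQ_part e g \<in> D \<and> s_coord e g \<in> A"
    by (simp add: da s_coord_HQ_mult_Umat HQ_part_HQ_mult_Umat)
next
  assume "det g = 1 \<and> g $ Inr e $ Inr e > 0 \<and> HQ_part e g \<in> D \<and> s_coord e g \<in> A"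
  then show "g \<in> flow_box e D A"
    unfolding flow_box_def using HQ_part_mult_Umat[of e g] by (metis (mono_tags, lifting) mem_Collect_eq)
qed

lemma flow_box_subset_SLn: "D \<subseteq> HQ e \<Longrightarrow> flow_box e D A \<subseteq> SLn"
  by (auto simp: flow_box_iff)

lemma flow_box_mono: "D \<subseteq> D' \<Longrightarrow> A \<subseteq> A' \<Longrightarrow> flow_box e D A \<subseteq> flow_box e D' A'"
  by (auto simp: flow_box_def)

lemma compact_flow_box:
  assumes "compact D" "compact A"
  shows "compact (flow_box e D A)"
proof -
  have "flow_box e D A = (\<lambda>(d, a). d ** Umat e (- a)) ` (D \<times> A)"
    by (auto simp: flow_box_def)
  also have "compact \<dots>"
    unfolding case_prod_beta by (intro compact_continuous_image compact_Times assms continuous_intros)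
  finally show ?thesis .
qed

lemma bounded_flow_box:
  fixes D :: "('k::finite, 'j::finite) mat set"
  assumes "D \<subseteq> HQ e" "compact (top_of_set (HQ e) closure_of D)" "bounded A"
  shows "bounded (flow_box e D A)"
proof (rule bounded_subset)
  show "bounded (flow_box e (top_of_set (HQ e) closure_of D) (closure A))"
    using assms(2,3) by (intro compact_imp_bounded compact_flow_box) simp_all
  show "flow_box e D A \<subseteq> flow_box e (top_of_set (HQ e) closure_of D) (closure A)"
    using assms(1) by (intro flow_box_mono closure_of_subset closure_subset) simp
qed

lemma openin_flow_box:
  fixes D :: "('k::finite, 'j::finite) mat set"
  assumes D: "openin (top_of_set (HQ e)) D" and A: "open A"
  shows "openin (top_of_set SLn) (flow_box e D A)"
proof -
  obtain U where U: "open U" "D = HQ e \<inter> U"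
    using D unfolding openin_open by blast
  let ?P = "{g :: ('k, 'j) mat. g $ Inr e $ Inr e > 0}"
  have "flow_box e D A = SLn \<inter> ((?P \<inter> HQ_part e -` U) \<inter> (?P \<inter> s_coord e -` A))"
    using U(2) HQ_part_in_HQ by (fastforce simp: flow_box_iff)
  moreover have "open ?P"
    by (intro open_Collect_less continuous_intros)
  then have "open ((?P \<inter> HQ_part e -` U) \<inter> (?P \<inter> s_coord e -` A))"
    by (intro open_Int continuous_open_preimage continuous_on_HQ_part continuous_on_s_coord U(1) A)
  ultimately show ?thesis
    by (simp add: openin_open_Int)
qed

lemma borel_flow_box:
  fixes D :: "('k::finite, 'j::finite) mat set"
  assumes "D \<subseteq> HQ e" and [measurable]: "D \<in> sets borel" "A \<in> sets borel"
  shows "flow_box e D A \<in> sets borel"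
proof -
  have "flow_box e D A
      = {g \<in> space borel. det g = 1 \<and> g $ Inr e $ Inr e > 0 \<and> HQ_part e g \<in> D \<and> s_coord e g \<in> A}"
    by (auto simp: flow_box_iff[OF assms(1)])
  also have "\<dots> \<in> sets borel" by measurable
  finally show ?thesis .
qed

lemma frontier_flow_box_subset:
  fixes D :: "('k::finite, 'j::finite) mat set"
  assumes D: "D \<subseteq> HQ e" "compact (top_of_set (HQ e) closure_of D)" and A: "bounded A"
  shows "top_of_set SLn frontier_of flow_box e D A
    \<subseteq> flow_box e (top_of_set (HQ e) frontier_of D) UNIV
      \<union> flow_box e (top_of_set (HQ e) closure_of D) (frontier A)"
proof
  let ?T = "top_of_set (HQ e)"
  have cl: "?T closure_of D \<subseteq> HQ e"
    using closure_of_subset_topspace[of ?T D] by simp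
  then have fr: "?T frontier_of D \<subseteq> HQ e" and int: "?T interior_of D \<subseteq> HQ e"
    using interior_of_subset_closure_of[of ?T D] by (auto simp: frontier_of_def)
  fix g assume g: "g \<in> top_of_set SLn frontier_of flow_box e D A"
  have "flow_box e D A \<subseteq> flow_box e (?T closure_of D) (closure A)"
    using D(1) by (intro flow_box_mono closure_of_subset closure_subset) simp
  moreover have "closed (flow_box e (?T closure_of D) (closure A))"
    using D(2) A by (intro compact_imp_closed compact_flow_box) simp_all
  ultimately have "closure (flow_box e D A) \<subseteq> flow_box e (?T closure_of D) (closure A)"
    by (rule closure_minimal)
  moreover have "g \<in> closure (flow_box e D A)"
    using g by (auto simp: frontier_of_def closure_of_subtopology intro: closure_mono[THEN subsetD])
  ultimately have g_cl: "g \<in> flow_box e (?T closure_of D) (closure A)" by blast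
  have "flow_box e (?T interior_of D) (interior A) \<subseteq> top_of_set SLn interior_of flow_box e D A"
    by (intro interior_of_maximal flow_box_mono interior_of_subset interior_subset openin_flow_box) simp_all
  then have "g \<notin> flow_box e (?T interior_of D) (interior A)"
    using g by (auto simp: frontier_of_def)
  with g_cl show "g \<in> flow_box e (?T frontier_of D) UNIV \<union> flow_box e (?T closure_of D) (frontier A)"
    unfolding Un_iff flow_box_iff[OF cl] flow_box_iff[OF fr] flow_box_iff[OF int]
    by (auto simp: frontier_of_def frontier_def)
qed

section \<open>Haar null sets\<close>

lemma
  assumes "haar_X mu"
  shows space_haar_X: "space mu = Xsp" and sets_haar_X: "sets mu = sets Xborel"
  using assms by (simp_all add: haar_X_def)

lemma sigma_finite_haar_X: "haar_X mu \<Longrightarrow> sigma_finite_measure mu"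
  by (simp add: haar_X_def prob_space_imp_sigma_finite)

lemma measurable_Xact_haar_X:
  assumes mu: "haar_X mu" and g: "det g = 1"
  shows "(\<lambda>x. Xact x g) \<in> measurable mu mu"
proof -
  note [measurable_cong] = sets_haar_X[OF mu]
  have "(\<lambda>x. x) \<in> measurable mu Xborel" by measurable
  then have "(\<lambda>x. Xact x g) \<in> measurable mu Xborel"
    by (rule measurable_Xact) (simp_all add: g)
  then show ?thesis by measurable
qed

lemma distr_haar_X:
  assumes mu: "haar_X mu" and g: "det g = 1"
  shows "distr mu mu (\<lambda>x. Xact x g) = mu"
proof (rule distr_eq_if_inverse_preserves_emeasure[OF measurable_Xact_haar_X[OF mu g]])
  interpret prob_space mu using mu by (simp add: haar_X_def)
  note space [simp] = space_haar_X[OF mu]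
  show "(\<lambda>x. Xact x (matrix_inv g)) \<in> space mu \<rightarrow> space mu"
    using g by (simp add: Xact_in_Xsp)
  show "Xact (Xact x g) (matrix_inv g) = x" "Xact (Xact x (matrix_inv g)) g = x" if "x \<in> space mu" for x
    using that g by (simp_all add: Xact_Xact Xact_mat_1)
  show "emeasure mu ((\<lambda>x. Xact x (matrix_inv g)) ` E) = emeasure mu E" if "E \<in> sets mu" for E
    using mu that g by (simp add: emeasure_eq_measure haar_X_def)
qed

lemma AE_haar_X_translate:
  assumes mu: "haar_X mu" and g: "det g = 1" and P: "AE x in mu. P x"
  shows "AE x in mu. P (Xact x g)"
  by (rule AE_distrD[OF measurable_Xact_haar_X[OF mu g]]) (simp only: distr_haar_X[OF mu g] P)

text \<open>By Fubini the translate of \<open>coset ` S\<close> by some \<open>(f y)\<^sup>-\<^sup>1\<close> is null, and \<open>mu\<close> is invariant.\<close>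
lemma coset_image_null:
  fixes mu :: "('k::finite, 'j::finite) mat set measure" and f :: "'a \<Rightarrow> ('k, 'j) mat"
  assumes mu: "haar_X mu" and Q: "sigma_finite_measure Q" "emeasure Q (space Q) \<noteq> 0"
    and f [measurable]: "f \<in> borel_measurable Q" and det_f: "\<And>y. y \<in> space Q \<Longrightarrow> det (f y) = 1"
    and S: "S \<in> sets borel" "S \<subseteq> SLn"
    and null: "\<And>g. det g = 1 \<Longrightarrow> AE y in Q. g ** f y \<notin> S"
  shows "coset ` S \<in> null_sets mu"
proof -
  note space = space_haar_X[OF mu] and sets = sets_haar_X[OF mu]
  have S': "coset ` S \<in> sets mu"
    using coset_image_Xborel[OF S] sets by simp
  have "\<exists>y\<in>space Q. AE x in mu. Xact x (f y) \<notin> coset ` S"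
  proof (rule AE_commute_ex[OF sigma_finite_haar_X[OF mu] Q(1) _ _ Q(2)])
    have [measurable]: "fst \<in> measurable (mu \<Otimes>\<^sub>M Q) Xborel"
      using measurable_fst[of mu Q] sets by (simp cong: measurable_cong_sets)
    have [measurable]: "coset ` S \<in> sets Xborel"
      by (rule coset_image_Xborel[OF S])
    have [measurable]: "(\<lambda>z. Xact (fst z) (f (snd z))) \<in> measurable (mu \<Otimes>\<^sub>M Q) Xborel"
      by (rule measurable_Xact) (auto simp: space_pair_measure det_f)
    show "{z \<in> space (mu \<Otimes>\<^sub>M Q). Xact (fst z) (f (snd z)) \<notin> coset ` S} \<in> sets (mu \<Otimes>\<^sub>M Q)"
      by measurable
    show "AE x in mu. AE y in Q. Xact x (f y) \<notin> coset ` S"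
    proof (rule AE_I2)
      fix x assume "x \<in> space mu"
      then obtain g where g: "det g = 1" "x = coset g"
        by (auto simp: space elim: XspE)
      have "AE y in Q. \<forall>\<gamma>\<in>Gamma. (\<gamma> ** g) ** f y \<notin> S"
        by (intro AE_ball_countable' countable_Gamma null) (simp add: det_mul g(1))
      then show "AE y in Q. Xact x (f y) \<notin> coset ` S"
        by (simp add: g(2) coset_image_iff matrix_mul_assoc)
    qed
  qed
  then obtain y where y: "y \<in> space Q" "AE x in mu. Xact x (f y) \<notin> coset ` S" by blast
  from AE_haar_X_translate[OF mu _ y(2), of "matrix_inv (f y)"]
  have "AE x in mu. Xact (Xact x (matrix_inv (f y))) (f y) \<notin> coset ` S"
    by (simp add: det_f y(1))
  then have "AE x in mu. x \<notin> coset ` S"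
    using AE_space by eventually_elim (simp add: space Xact_Xact Xact_mat_1 det_f y(1))
  then show ?thesis
    by (simp add: AE_iff_null_sets[OF S'])
qed

lemma coset_flow_box_null_if_hit_times_null:
  fixes mu :: "('k::finite, 'j::finite) mat set measure"
  assumes mu: "haar_X mu" and D: "D \<subseteq> HQ e" "D \<in> sets borel" and A: "A \<in> null_sets lborel"
  shows "coset ` flow_box e D A \<in> null_sets mu"
proof (rule coset_image_null[OF mu sigma_finite_lborel])
  show "(Umat e :: real ^ 'k \<Rightarrow> ('k, 'j) mat) \<in> borel_measurable lborel" by measurable
  show "flow_box e D A \<in> sets borel"
    using A by (intro borel_flow_box D) auto
  show "flow_box e D A \<subseteq> SLn"
    by (rule flow_box_subset_SLn[OF D(1)])
  fix g :: "('k, 'j) mat" assume "det g = 1"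
  have "AE s in lborel. s_coord e g - s \<notin> A"
    using AE_lborel_affine[OF AE_not_in[OF A], of "-1" "s_coord e g"] by simp
  then show "AE s in lborel. g ** Umat e s \<notin> flow_box e D A"
    by eventually_elim (auto simp: flow_box_iff[OF D(1)] mult_Umat_Inr s_coord_mult_Umat)
qed simp_all

text \<open>Unlike rescaling a row, rescaling a column commutes with left multiplication; unlike rescaling the
  whole matrix, it leaves the other columns unchanged.\<close>
definition unimod :: "'n \<Rightarrow> real ^ 'n ^ 'n \<Rightarrow> real ^ 'n ^ 'n" where
  "unimod q M = (\<chi> i j. if j = q then M $ i $ j / det M else M $ i $ j)"

lemma det_unimod:
  assumes "det M \<noteq> 0"
  shows "det (unimod q M) = 1"
proof -
  have "transpose (unimod q M)
      = (\<chi> j. if j = q then inverse (det M) *s transpose M $ j else transpose M $ j)"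
    by (simp add: vec_eq_iff unimod_def transpose_def divide_inverse mult.commute)
  then have "det (transpose (unimod q M))
      = inverse (det M) * det (\<chi> j. if j = q then transpose M $ j else transpose M $ j)"
    by (simp only: det_row_mul)
  then show ?thesis
    using assms by simp
qed

lemma unimod_matrix_mult:
  assumes "det g = 1"
  shows "unimod q (g ** M) = g ** unimod q M"
proof -
  have "det (g ** M) = det M"
    using assms by (simp add: det_mul)
  then show ?thesis
    unfolding unimod_def by (simp add: matrix_matrix_mult_def vec_eq_iff sum_divide_distrib)
qed

lemma borel_measurable_unimod [measurable]: "unimod (q :: 'n::finite) \<in> borel_measurable borel"
proof -
  have "(\<lambda>M :: real ^ 'n ^ 'n. if j = q then M $ i $ j / det M else M $ i $ j) \<in> borel_measurable borel"
    for i j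
    by measurable
  then show ?thesis
    unfolding unimod_def[abs_def] by (intro borel_measurable_vec_lambda)
qed

lemma coset_null_if_unimod_null:
  fixes mu :: "('k::finite, 'j::finite) mat set measure"
  assumes mu: "haar_X mu" and S: "S \<in> sets borel" "S \<subseteq> SLn"
    and null: "AE M in lborel. det M \<noteq> 0 \<longrightarrow> unimod q M \<notin> S"
  shows "coset ` S \<in> null_sets mu"
proof -
  let ?GL = "{M :: ('k, 'j) mat. det M \<noteq> 0}"
  let ?Q = "restrict_space lborel ?GL"
  have open_GL: "open ?GL"
    by (intro open_Collect_neq continuous_intros)
  show ?thesis
  proof (rule coset_image_null[OF mu _ _ _ _ S])
    show "sigma_finite_measure ?Q"
      using open_GL by (intro sigma_finite_measure_restrict_space sigma_finite_lborel) simp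
    have "mat 1 \<in> ?GL" by simp
    then have "\<not> negligible ?GL"
      using open_GL open_not_negligible by blast
    then show "emeasure ?Q (space ?Q) \<noteq> 0"
      using open_GL
      by (simp add: negligible_iff_null_sets null_sets_completion_iff null_sets_def
          space_restrict_space emeasure_restrict_space)
    show "unimod q \<in> borel_measurable ?Q"
      by (intro measurable_restrict_space1) simp
    show "det (unimod q M) = 1" if "M \<in> space ?Q" for M
      using that by (simp add: space_restrict_space det_unimod)
    fix g :: "('k, 'j) mat" assume g: "det g = 1"
    then have "AE M in lborel. det (g ** M) \<noteq> 0 \<longrightarrow> unimod q (g ** M) \<notin> S"
      by (intro AE_lborel_matrix_mult null) simp
    with g show "AE M in ?Q. g ** unimod q M \<notin> S"
      using open_GL by (simp add: AE_restrict_space_iff det_mul unimod_matrix_mult)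
  qed
qed

lemma sets_haar_H:
  assumes "haar_H e MH"
  shows "sets MH = sets (restrict_space borel (Hgrp e))"
  using assms by (simp add: haar_H_def)

lemma space_haar_H: "haar_H e MH \<Longrightarrow> space MH = Hgrp e"
  using sets_eq_imp_space_eq[OF sets_haar_H] by (simp add: space_restrict_space)

lemma sets_haar_H_iff: "haar_H e MH \<Longrightarrow> S \<in> sets MH \<longleftrightarrow> S \<subseteq> Hgrp e \<and> S \<in> sets borel"
  by (simp add: sets_haar_H sets_restrict_space_iff borel_closed closed_Hgrp)

lemma measurable_haar_H_id: "haar_H e MH \<Longrightarrow> (\<lambda>h. h) \<in> borel_measurable MH"
  by (simp add: sets_haar_H measurable_restrict_space1 cong: measurable_cong_sets)

lemma sigma_finite_haar_H:
  fixes MH :: "('k::finite, 'j::finite) mat measure"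
  assumes MH: "haar_H e MH"
  shows "sigma_finite_measure MH"
proof
  let ?B = "\<lambda>n. Hgrp e \<inter> cball (0 :: ('k, 'j) mat) (real n)"
  have "compact (?B n)" for n
    by (intro closed_Int_compact closed_Hgrp compact_cball)
  then have "emeasure MH (?B n) \<noteq> \<infinity>" for n
    using MH unfolding haar_H_def by (metis Int_lower1 less_irrefl)
  moreover have "\<Union>(range ?B) = space MH"
    by (auto simp: space_haar_H[OF MH] real_arch_simple)
  moreover have "range ?B \<subseteq> sets MH"
    by (auto simp: sets_haar_H_iff[OF MH] closed_Hgrp intro!: borel_closed)
  ultimately show "\<exists>A. countable A \<and> A \<subseteq> sets MH \<and> \<Union>A = space MH \<and> (\<forall>a\<in>A. emeasure MH a \<noteq> \<infinity>)"
    by (intro exI[of _ "range ?B"]) auto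
qed

lemma emeasure_haar_H_nonzero:
  assumes "haar_H e MH"
  shows "emeasure MH (space MH) \<noteq> 0"
  unfolding space_haar_H[OF assms] using assms mat_1_in_Hgrp unfolding haar_H_def
  by (metis empty_iff less_irrefl openin_subtopology_self)

lemma measurable_Hgrp_mult:
  assumes MH: "haar_H e MH" and a: "a \<in> Hgrp e"
  shows "(\<lambda>h. a ** h) \<in> measurable MH MH"
proof -
  note [measurable_cong] = sets_haar_H[OF MH] and [measurable] = measurable_haar_H_id[OF MH]
  have "(\<lambda>h. a ** h) \<in> measurable MH (restrict_space borel (Hgrp e))"
    using a by (intro measurable_restrict_space2) (auto simp: space_haar_H[OF MH] Hgrp_mult)
  then show ?thesis by measurable
qed

lemma distr_haar_H:
  assumes MH: "haar_H e MH" and a: "a \<in> Hgrp e"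
  shows "distr MH MH (\<lambda>h. a ** h) = MH"
proof (rule distr_eq_if_inverse_preserves_emeasure[OF measurable_Hgrp_mult[OF MH a]])
  have inv: "matrix_inv a \<in> Hgrp e"
    by (rule Hgrp_matrix_inv[OF a])
  then show "(\<lambda>h. matrix_inv a ** h) \<in> space MH \<rightarrow> space MH"
    by (simp add: space_haar_H[OF MH] Hgrp_mult)
  show "emeasure MH ((\<lambda>h. matrix_inv a ** h) ` S) = emeasure MH S" if "S \<in> sets MH" for S
    using MH that inv by (simp add: haar_H_def)
qed (use a in simp_all)

lemma AE_haar_H_mult:
  assumes MH: "haar_H e MH" and a: "a \<in> Hgrp e" and P: "AE h in MH. P h"
  shows "AE h in MH. P (a ** h)"
  by (rule AE_distrD[OF measurable_Hgrp_mult[OF MH a]]) (simp only: distr_haar_H[OF MH a] P)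

text \<open>For almost every \<open>y\<close> the condition \<open>P (x\<^sup>-\<^sup>1 y)\<close> holds for almost every \<open>x\<close>; replacing \<open>x\<close> by
  \<open>y x\<close> removes \<open>y\<close>.\<close>
lemma AE_haar_H_inverse:
  fixes MH :: "('k::finite, 'j::finite) mat measure"
  assumes MH: "haar_H e MH" and P: "AE h in MH. P h"
  shows "AE h in MH. P (matrix_inv h)"
proof -
  note space = space_haar_H[OF MH] and [measurable] = measurable_haar_H_id[OF MH]
  obtain N where N: "\<forall>h. h \<in> Hgrp e - N \<longrightarrow> P h" "N \<in> null_sets MH"
    using P by (auto simp: space elim: AE_E3)
  then have [measurable]: "N \<in> sets borel"
    using sets_haar_H_iff[OF MH] by blast
  have "\<exists>y\<in>space MH. AE x in MH. matrix_inv x ** y \<notin> N"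
  proof (rule AE_commute_ex)
    have [measurable]: "fst \<in> borel_measurable (MH \<Otimes>\<^sub>M MH)" "snd \<in> borel_measurable (MH \<Otimes>\<^sub>M MH)"
      using measurable_compose[OF measurable_fst measurable_haar_H_id[OF MH]]
        measurable_compose[OF measurable_snd measurable_haar_H_id[OF MH]] by auto
    have [measurable]: "(\<lambda>z. matrix_inv (fst z)) \<in> borel_measurable (MH \<Otimes>\<^sub>M MH)"
      by (rule borel_measurable_matrix_inv) (auto simp: space_pair_measure space)
    show "{z \<in> space (MH \<Otimes>\<^sub>M MH). matrix_inv (fst z) ** snd z \<notin> N} \<in> sets (MH \<Otimes>\<^sub>M MH)"
      by measurable
    show "AE x in MH. AE y in MH. matrix_inv x ** y \<notin> N"
    proof (rule AE_I2)
      fix x assume "x \<in> space MH"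
      then show "AE y in MH. matrix_inv x ** y \<notin> N"
        by (intro AE_haar_H_mult[OF MH] AE_not_in N(2) Hgrp_matrix_inv) (simp add: space)
    qed
  qed (simp_all add: sigma_finite_haar_H[OF MH] emeasure_haar_H_nonzero[OF MH])
  then obtain y where y: "y \<in> Hgrp e" "AE x in MH. matrix_inv x ** y \<notin> N"
    by (auto simp: space)
  then have "AE x in MH. matrix_inv (y ** x) ** y \<notin> N"
    by (intro AE_haar_H_mult[OF MH])
  then show ?thesis
    using AE_space
  proof eventually_elim
    fix x assume "matrix_inv (y ** x) ** y \<notin> N" "x \<in> space MH"
    then show "P (matrix_inv x)"
      using y(1) N(1) by (auto simp: space matrix_inv_mult Hgrp_matrix_inv)
  qed
qed

lemma AE_haar_H_inverse_mult_notin_flow_box: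
  assumes MH: "haar_H e MH" and C: "C \<subseteq> HQ e" and g: "det g = 1"
    and AE: "w_coord e g \<in> Wpos e \<Longrightarrow> AE h in MH. h ** Rmat e (w_coord e g) \<notin> C"
  shows "AE h in MH. matrix_inv h ** g \<notin> flow_box e C A"
proof (cases "g $ Inr e $ Inr e > 0")
  case True
  then obtain h0 where h0: "h0 \<in> Hgrp e" "HQ_part e g = h0 ** Rmat e (w_coord e g)"
    using Hgrp_Rmat_decomp[of "HQ_part e g" e] HQ_part_in_HQ[OF g, of e]
    by (auto simp: HQ_iff w_coord_HQ_part)
  have "AE h in MH. h ** Rmat e (w_coord e g) \<notin> C"
    using AE True by (simp add: Wpos_def w_coord_def)
  then have "AE h in MH. matrix_inv h ** Rmat e (w_coord e g) \<notin> C"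
    by (rule AE_haar_H_inverse[OF MH])
  then have "AE h in MH. matrix_inv (matrix_inv h0 ** h) ** Rmat e (w_coord e g) \<notin> C"
    by (rule AE_haar_H_mult[OF MH Hgrp_matrix_inv[OF h0(1)]])
  then show ?thesis
    using AE_space
  proof eventually_elim
    fix h assume h: "matrix_inv (matrix_inv h0 ** h) ** Rmat e (w_coord e g) \<notin> C" "h \<in> space MH"
    then have "HQ_part e (matrix_inv h ** g) \<notin> C"
      using h0 by (simp add: space_haar_H[OF MH] HQ_part_Hgrp_mult Hgrp_matrix_inv matrix_inv_mult
          matrix_mul_assoc)
    then show "matrix_inv h ** g \<notin> flow_box e C A"
      by (simp add: flow_box_iff[OF C])
  qed
next
  case False
  have "matrix_inv h ** g \<notin> flow_box e C A" if "h \<in> Hgrp e" for h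
    using False Hgrp_mult_last_row[OF Hgrp_matrix_inv[OF that], of g] by (simp add: flow_box_iff[OF C])
  then show ?thesis
    by (intro AE_I2) (simp add: space_haar_H[OF MH])
qed

lemma AE_nu_null:
  fixes MH :: "('k::finite, 'j::finite) mat measure"
  assumes MH: "haar_H e MH" and nu: "nu_null e MH C"
  shows "AE w in lborel. w \<in> Wpos e \<longrightarrow> (AE h in MH. h ** Rmat e w \<notin> C)"
proof -
  interpret pair_sigma_finite MH "lborel :: (real ^ 'j) measure"
    by (simp add: pair_sigma_finite_def sigma_finite_haar_H[OF MH] sigma_finite_lborel)
  define T where "T = {(h, w). h \<in> Hgrp e \<and> w \<in> Wpos e \<and> h ** Rmat e w \<in> C}"
  have T: "T \<in> null_sets (MH \<Otimes>\<^sub>M lborel)"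
    using nu by (simp add: nu_null_def T_def)
  then have [measurable]: "T \<in> sets (MH \<Otimes>\<^sub>M lborel)" by auto
  have "{z \<in> space (MH \<Otimes>\<^sub>M lborel). (fst z, snd z) \<notin> T} \<in> sets (MH \<Otimes>\<^sub>M lborel)"
    unfolding prod.collapse by measurable
  moreover have "AE h in MH. AE w in lborel. (h, w) \<notin> T"
    using AE_not_in[OF T] by (rule AE_pair)
  ultimately have "AE w in lborel. AE h in MH. (h, w) \<notin> T"
    using AE_commute[of "\<lambda>h w. (h, w) \<notin> T"] by blast
  then show ?thesis
  proof (rule eventually_mono, intro impI)
    fix w assume "AE h in MH. (h, w) \<notin> T" "w \<in> Wpos e"
    from this(1) AE_space show "AE h in MH. h ** Rmat e w \<notin> C"
      by eventually_elim (use \<open>w \<in> Wpos e\<close> in \<open>simp add: T_def space_haar_H[OF MH]\<close>)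
  qed
qed

lemma linear_w_coord: "linear (w_coord e :: ('k::finite, 'j::finite) mat \<Rightarrow> real ^ 'j)"
  by (rule linearI) (simp_all add: w_coord_def vec_eq_iff)

lemma surj_w_coord: "surj (w_coord e :: ('k::finite, 'j::finite) mat \<Rightarrow> real ^ 'j)"
  by (rule surjI[of _ "Rmat e"]) (simp add: w_coord_def)

text \<open>Averaging over left translations by \<open>h\<^sup>-\<^sup>1\<close>, \<open>h \<in> H\<close>, turns a statement about Lebesgue measure on
  matrices into one about Haar measure on \<open>H\<close> for almost every \<open>w\<close>. With \<open>h\<close> in place of \<open>h\<^sup>-\<^sup>1\<close> it
  would involve right translates of Haar null sets.\<close>
lemma AE_unimod_notin_flow_box:
  fixes MH :: "('k::finite, 'j::finite) mat measure"
  assumes MH: "haar_H e MH" and C: "C \<subseteq> HQ e" "C \<in> sets borel" and nu: "nu_null e MH C"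
  shows "AE M in lborel. det M \<noteq> 0 \<longrightarrow> unimod (Inl a) M \<notin> flow_box e C UNIV"
proof -
  let ?S = "flow_box e C UNIV" and ?u = "unimod (Inl a) :: ('k, 'j) mat \<Rightarrow> _"
  have "\<exists>h\<in>space MH. AE M in lborel. det M \<noteq> 0 \<longrightarrow> matrix_inv h ** ?u M \<notin> ?S"
  proof (rule AE_commute_ex)
    have [measurable]: "?S \<in> sets borel"
      using C by (intro borel_flow_box) simp_all
    have [measurable]: "(\<lambda>z. matrix_inv (snd z)) \<in> borel_measurable (lborel \<Otimes>\<^sub>M MH)"
      using measurable_compose[OF measurable_snd measurable_haar_H_id[OF MH]]
      by (intro borel_measurable_matrix_inv) (auto simp: space_pair_measure space_haar_H[OF MH])
    show "{z \<in> space (lborel \<Otimes>\<^sub>M MH). det (fst z) \<noteq> 0 \<longrightarrow> matrix_inv (snd z) ** ?u (fst z) \<notin> ?S}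
        \<in> sets (lborel \<Otimes>\<^sub>M MH)"
      by measurable
    show "AE M in lborel. AE h in MH. det M \<noteq> 0 \<longrightarrow> matrix_inv h ** ?u M \<notin> ?S"
      using AE_lborel_linear_surj[OF linear_w_coord surj_w_coord AE_nu_null[OF MH nu]]
    proof eventually_elim
      fix M :: "('k, 'j) mat"
      assume M: "w_coord e M \<in> Wpos e \<longrightarrow> (AE h in MH. h ** Rmat e (w_coord e M) \<notin> C)"
      have "w_coord e (?u M) = w_coord e M"
        by (simp add: w_coord_def unimod_def)
      with M have "AE h in MH. matrix_inv h ** ?u M \<notin> ?S" if "det M \<noteq> 0"
        using that by (intro AE_haar_H_inverse_mult_notin_flow_box[OF MH C(1)]) (simp_all add: det_unimod)
      then show "AE h in MH. det M \<noteq> 0 \<longrightarrow> matrix_inv h ** ?u M \<notin> ?S"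
        by (cases "det M = 0") simp_all
    qed
  qed (simp_all add: sigma_finite_lborel sigma_finite_haar_H[OF MH] emeasure_haar_H_nonzero[OF MH])
  then obtain h where h: "h \<in> Hgrp e" "AE M in lborel. det M \<noteq> 0 \<longrightarrow> matrix_inv h ** ?u M \<notin> ?S"
    by (auto simp: space_haar_H[OF MH])
  then have "AE M in lborel. det (h ** M) \<noteq> 0 \<longrightarrow> matrix_inv h ** ?u (h ** M) \<notin> ?S"
    by (intro AE_lborel_matrix_mult) simp_all
  then show ?thesis
    using h(1) by (simp add: det_mul unimod_matrix_mult)
qed

lemma coset_flow_box_null_if_nu_null:
  fixes mu :: "('k::finite, 'j::finite) mat set measure"
  assumes mu: "haar_X mu" and MH: "haar_H e MH"
    and C: "C \<subseteq> HQ e" "C \<in> sets borel" and nu: "nu_null e MH C"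
  shows "coset ` flow_box e C UNIV \<in> null_sets mu"
proof (rule coset_null_if_unimod_null[OF mu])
  show "flow_box e C UNIV \<in> sets borel"
    using C by (intro borel_flow_box) simp_all
  show "flow_box e C UNIV \<subseteq> SLn"
    by (rule flow_box_subset_SLn[OF C(1)])
  show "AE M in lborel. det M \<noteq> 0 \<longrightarrow> unimod (Inl undefined) M \<notin> flow_box e C UNIV"
    by (rule AE_unimod_notin_flow_box[OF MH C nu])
qed

lemma coset_frontier_flow_box_null:
  fixes mu :: "('k::finite, 'j::finite) mat set measure"
  assumes mu: "haar_X mu" and MH: "haar_H e MH" and A: "bounded A" "frontier A \<in> null_sets lborel"
    and D: "D \<subseteq> HQ e" "compact (top_of_set (HQ e) closure_of D)"
      "nu_null e MH (top_of_set (HQ e) frontier_of D)"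
  shows "coset ` (top_of_set SLn frontier_of flow_box e D A) \<in> null_sets mu"
proof (rule null_sets_subset)
  let ?T = "top_of_set (HQ e)"
  have cl: "?T closure_of D \<subseteq> HQ e"
    using closure_of_subset_topspace[of ?T D] by simp
  have fr: "?T frontier_of D \<subseteq> ?T closure_of D"
    by (auto simp: frontier_of_def)
  have "compact (?T frontier_of D)"
    by (rule closedin_compact[OF D(2) closedin_subset_trans[OF closedin_frontier_of fr cl]])
  then have "coset ` flow_box e (?T frontier_of D) UNIV \<in> null_sets mu"
    using fr cl D(3) by (intro coset_flow_box_null_if_nu_null[OF mu MH] borel_compact) auto
  moreover have "coset ` flow_box e (?T closure_of D) (frontier A) \<in> null_sets mu"
    using A(2) by (intro coset_flow_box_null_if_hit_times_null[OF mu cl] borel_compact D(2))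
  ultimately show "coset ` flow_box e (?T frontier_of D) UNIV
      \<union> coset ` flow_box e (?T closure_of D) (frontier A) \<in> null_sets mu"
    by (rule null_sets.Un)
  have "closed (top_of_set SLn frontier_of flow_box e D A)"
    by (rule closedin_closed_trans[OF closedin_frontier_of closed_SLn])
  then show "coset ` (top_of_set SLn frontier_of flow_box e D A) \<in> sets mu"
    using frontier_of_subset_topspace[of "top_of_set SLn" "flow_box e D A"] sets_haar_X[OF mu]
    by (simp add: coset_image_Xborel borel_closed)
  show "coset ` (top_of_set SLn frontier_of flow_box e D A)
      \<subseteq> coset ` flow_box e (?T frontier_of D) UNIV \<union> coset ` flow_box e (?T closure_of D) (frontier A)"
    using frontier_flow_box_subset[OF D(1,2) A(1)] by blast
qed

section \<open>Hit counts\<close>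

definition lattice_hits :: "('k::finite, 'j::finite) mat set \<Rightarrow> ('k, 'j) mat \<Rightarrow> ('k, 'j) mat set" where
  "lattice_hits B g = {\<gamma> \<in> Gamma. \<gamma> ** g \<in> B}"

definition count_event ::
    "nat \<Rightarrow> (nat \<Rightarrow> ('k::finite, 'j::finite) mat set) \<Rightarrow> (nat \<Rightarrow> nat) \<Rightarrow> ('k, 'j) mat set set" where
  "count_event r B N = {coset g | g. g \<in> SLn \<and>
    (\<forall>i<r. finite (lattice_hits (B i) g) \<and> card (lattice_hits (B i) g) = N i)}"

lemma bij_betw_lattice_hits_mult:
  fixes g :: "('k::finite, 'j::finite) mat"
  assumes \<gamma>: "\<gamma> \<in> Gamma"
  shows "bij_betw (\<lambda>\<delta>. \<delta> ** \<gamma>) (lattice_hits B (\<gamma> ** g)) (lattice_hits B g)"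
proof (rule bij_betw_byWitness[where f' = "\<lambda>\<delta>. \<delta> ** matrix_inv \<gamma>"])
  show "(\<lambda>\<delta>. \<delta> ** \<gamma>) ` lattice_hits B (\<gamma> ** g) \<subseteq> lattice_hits B g"
    using Gamma_mult[OF _ \<gamma>] by (auto simp: lattice_hits_def matrix_mul_assoc)
  have "\<delta> ** matrix_inv \<gamma> ** (\<gamma> ** g) = \<delta> ** g" for \<delta> :: "('k, 'j) mat"
    using \<gamma> by (simp add: matrix_mul_assoc)
  then show "(\<lambda>\<delta>. \<delta> ** matrix_inv \<gamma>) ` lattice_hits B g \<subseteq> lattice_hits B (\<gamma> ** g)"
    using Gamma_mult[OF _ Gamma_matrix_inv[OF \<gamma>]] by (auto simp: lattice_hits_def)
qed (use \<gamma> in simp_all)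

lemma coset_in_count_event_iff:
  assumes "det g = 1"
  shows "coset g \<in> count_event r B N
    \<longleftrightarrow> (\<forall>i<r. finite (lattice_hits (B i) g) \<and> card (lattice_hits (B i) g) = N i)"
proof
  assume "coset g \<in> count_event r B N"
  then obtain \<gamma> g' where "\<gamma> \<in> Gamma" "g = \<gamma> ** g'"
      "\<forall>i<r. finite (lattice_hits (B i) g') \<and> card (lattice_hits (B i) g') = N i"
    by (auto simp: count_event_def coset_eq_iff)
  then show "\<forall>i<r. finite (lattice_hits (B i) g) \<and> card (lattice_hits (B i) g) = N i"
    using bij_betw_lattice_hits_mult bij_betw_finite bij_betw_same_card by metis
qed (use assms in \<open>auto simp: count_event_def\<close>)

lemma count_event_subset_Xsp: "count_event r B N \<subseteq> Xsp"
  by (auto simp: count_event_def coset_in_Xsp)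

lemma sets_count_event:
  fixes B :: "nat \<Rightarrow> ('k::finite, 'j::finite) mat set"
  assumes B: "\<And>i. i < r \<Longrightarrow> B i \<in> sets borel"
  shows "count_event r B N \<in> sets Xborel"
  unfolding sets_Xborel_iff
proof (intro conjI count_event_subset_Xsp)
  have "{g \<in> SLn. coset g \<in> count_event r B N} = SLn \<inter> {g \<in> space borel. \<forall>i\<in>{..<r}.
      finite {\<gamma> \<in> Gamma. \<gamma> ** g \<in> B i} \<and> card {\<gamma> \<in> Gamma. \<gamma> ** g \<in> B i} = N i}"
    by (auto simp: coset_in_count_event_iff lattice_hits_def)
  also have "\<dots> \<in> sets borel"
  proof (intro sets.Int borel_closed[OF closed_SLn] sets.sets_Collect_finite_All
      measurable_finite_card_eq countable_Gamma)
    fix i and \<gamma> :: "('k, 'j) mat" assume "i \<in> {..<r}"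
    then have [measurable]: "B i \<in> sets borel" by (simp add: B)
    show "{g \<in> space borel. \<gamma> ** g \<in> B i} \<in> sets borel" by measurable
  qed simp
  finally show "{g \<in> SLn. coset g \<in> count_event r B N} \<in> sets borel" .
qed

lemma left_mult_membership_locally_constant:
  fixes B :: "('k::finite, 'j::finite) mat set"
  assumes a: "det a = 1" and g: "det g = 1" and frontier: "a ** g \<notin> top_of_set SLn frontier_of B"
  shows "\<exists>U. openin (top_of_set SLn) U \<and> g \<in> U \<and> (\<forall>v\<in>U. a ** v \<in> B \<longleftrightarrow> a ** g \<in> B)"
proof -
  have "a ** g \<in> topspace (top_of_set SLn)"
    using a g by (simp add: det_mul)
  from frontier obtain V where V: "openin (top_of_set SLn) V" "a ** g \<in> V" "\<forall>v\<in>V. v \<in> B \<longleftrightarrow> a ** g \<in> B"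
    unfolding notin_frontier_of_iff_locally_constant[OF \<open>a ** g \<in> topspace (top_of_set SLn)\<close>] by blast
  show ?thesis
  proof (intro exI conjI)
    show "openin (top_of_set SLn) (SLn \<inter> (\<lambda>v. a ** v) -` V)"
      by (rule openin_left_mult_vimage[OF V(1) a])
    show "g \<in> SLn \<inter> (\<lambda>v. a ** v) -` V"
      using V(2) g by simp
    show "\<forall>v\<in>SLn \<inter> (\<lambda>v. a ** v) -` V. a ** v \<in> B \<longleftrightarrow> a ** g \<in> B"
      using V(3) by blast
  qed
qed

lemma lattice_hits_locally_constant:
  fixes B :: "('k::finite, 'j::finite) mat set"
  assumes B: "B \<subseteq> SLn" "bounded B" and g: "det g = 1"
    and frontier: "coset g \<notin> coset ` (top_of_set SLn frontier_of B)"
  shows "\<exists>U. openin (top_of_set SLn) U \<and> g \<in> U \<and> (\<forall>v\<in>U. lattice_hits B v = lattice_hits B g)"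
proof -
  have "\<gamma> ** g \<notin> top_of_set SLn frontier_of B" if "\<gamma> \<in> Gamma" for \<gamma>
    using frontier that by (auto simp: coset_image_iff)
  then have "\<exists>U. openin (top_of_set SLn) U \<and> g \<in> U \<and> (\<forall>v\<in>U. \<gamma> ** v \<in> B \<longleftrightarrow> \<gamma> ** g \<in> B)"
    if "\<gamma> \<in> Gamma" for \<gamma>
    using that by (intro left_mult_membership_locally_constant g) simp_all
  then obtain U where U: "\<And>\<gamma>. \<gamma> \<in> Gamma \<Longrightarrow> openin (top_of_set SLn) (U \<gamma>)" "\<And>\<gamma>. \<gamma> \<in> Gamma \<Longrightarrow> g \<in> U \<gamma>"
      "\<And>\<gamma> v. \<gamma> \<in> Gamma \<Longrightarrow> v \<in> U \<gamma> \<Longrightarrow> \<gamma> ** v \<in> B \<longleftrightarrow> \<gamma> ** g \<in> B"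
    by metis
  define I where "I = {\<gamma> \<in> Gamma. \<exists>v\<in>SLn \<inter> cball g 1. \<gamma> ** v \<in> closure B}"
  have "finite I"
    unfolding I_def using B(2)
    by (intro Gamma_properly_discontinuous closed_Int_compact closed_SLn) auto
  let ?V = "(SLn \<inter> ball g 1) \<inter> (SLn \<inter> (\<Inter>\<gamma>\<in>I. U \<gamma>))"
  have "openin (top_of_set SLn) (SLn \<inter> (\<Inter>\<gamma>\<in>I. U \<gamma>))"
    using openin_INT[OF \<open>finite I\<close>, of "top_of_set SLn" U] U(1) by (simp add: I_def Int_commute)
  then have "openin (top_of_set SLn) ?V"
    by (rule openin_Int[OF openin_open_Int[OF open_ball]])
  moreover have "g \<in> ?V"
    using U(2) g by (auto simp: I_def)
  moreover have "\<gamma> ** v \<in> B \<longleftrightarrow> \<gamma> ** g \<in> B" if "v \<in> ?V" "\<gamma> \<in> Gamma" for v \<gamma>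
  proof (cases "\<gamma> \<in> I")
    case True
    then show ?thesis using U(3) that by blast
  next
    case False
    moreover have "v \<in> SLn \<inter> cball g 1" "g \<in> SLn \<inter> cball g 1"
      using that(1) g by auto
    ultimately show ?thesis
      using that(2) closure_subset[of B] unfolding I_def by blast
  qed
  then have "\<forall>v\<in>?V. lattice_hits B v = lattice_hits B g"
    by (auto simp: lattice_hits_def)
  ultimately show ?thesis by blast
qed

lemma Xbd_count_event_subset:
  fixes B :: "nat \<Rightarrow> ('k::finite, 'j::finite) mat set"
  assumes B: "\<And>i. i < r \<Longrightarrow> B i \<subseteq> SLn" "\<And>i. i < r \<Longrightarrow> bounded (B i)"
  shows "Xbd (count_event r B N) \<subseteq> (\<Union>i<r. coset ` (top_of_set SLn frontier_of B i))"
proof (rule subsetI, rule ccontr)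
  fix x assume x: "x \<in> Xbd (count_event r B N)"
    and frontier: "x \<notin> (\<Union>i<r. coset ` (top_of_set SLn frontier_of B i))"
  have "x \<in> topspace Xtop"
    using x frontier_of_subset_topspace[of Xtop] unfolding Xbd_def by blast
  then obtain g where g: "det g = 1" "x = coset g"
    by (auto elim: XspE)
  have "\<exists>U. openin (top_of_set SLn) U \<and> g \<in> U \<and> (\<forall>v\<in>U. lattice_hits (B i) v = lattice_hits (B i) g)"
    if "i < r" for i
    using that frontier g by (intro lattice_hits_locally_constant B) auto
  then obtain U where U: "\<And>i. i < r \<Longrightarrow> openin (top_of_set SLn) (U i)" "\<And>i. i < r \<Longrightarrow> g \<in> U i"
      and hits: "\<And>i v. i < r \<Longrightarrow> v \<in> U i \<Longrightarrow> lattice_hits (B i) v = lattice_hits (B i) g"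
    by metis
  let ?V = "SLn \<inter> (\<Inter>i<r. U i)"
  have "openin (top_of_set SLn) ?V"
    using openin_INT[of "{..<r}" "top_of_set SLn" U] U(1) by (simp add: Int_commute)
  then have "openin Xtop (coset ` ?V)"
    by (rule openin_coset_image)
  moreover have "coset g \<in> coset ` ?V"
    using U(2) g(1) by simp
  moreover have "coset v \<in> count_event r B N \<longleftrightarrow> coset g \<in> count_event r B N" if "v \<in> ?V" for v
  proof -
    have "lattice_hits (B i) v = lattice_hits (B i) g" if "i < r" for i
      using that \<open>v \<in> ?V\<close> by (intro hits) auto
    then show ?thesis
      using that g(1) by (simp add: coset_in_count_event_iff)
  qed
  then have "\<forall>y\<in>coset ` ?V. y \<in> count_event r B N \<longleftrightarrow> coset g \<in> count_event r B N"
    by blast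
  ultimately have "x \<notin> Xtop frontier_of count_event r B N"
    unfolding notin_frontier_of_iff_locally_constant[OF \<open>x \<in> topspace Xtop\<close>] unfolding g(2) by blast
  then show False
    using x by (simp add: Xbd_def)
qed

lemma Xbd_count_event_null:
  fixes mu :: "('k::finite, 'j::finite) mat set measure"
  assumes mu: "haar_X mu"
    and B: "\<And>i. i < r \<Longrightarrow> B i \<subseteq> SLn" "\<And>i. i < r \<Longrightarrow> bounded (B i)"
    and null: "\<And>i. i < r \<Longrightarrow> coset ` (top_of_set SLn frontier_of B i) \<in> null_sets mu"
  shows "Xbd (count_event r B N) \<in> null_sets mu"
proof (rule null_sets_subset)
  show "(\<Union>i<r. coset ` (top_of_set SLn frontier_of B i)) \<in> null_sets mu"
    using null by (intro null_sets_UN') auto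
  have "openin Xtop (Xsp - Xbd (count_event r B N))"
    using closedin_frontier_of[of Xtop "count_event r B N"] by (simp add: Xbd_def closedin_def)
  from sets.compl_sets[OF openin_Xborel[OF this]]
  have "Xsp - (Xsp - Xbd (count_event r B N)) \<in> sets Xborel" by simp
  then show "Xbd (count_event r B N) \<in> sets mu"
    using frontier_of_subset_topspace[of Xtop "count_event r B N"]
    by (simp add: sets_haar_X[OF mu] Xbd_def double_diff)
qed (rule Xbd_count_event_subset[OF B])

lemma bij_betw_lattice_hits_hits:
  fixes g :: "('k::finite, 'j::finite) mat"
  assumes g: "det g = 1" and D: "D \<subseteq> Sigma1 e F W" "D \<subseteq> HQ e"
  shows "bij_betw (\<lambda>\<gamma>. (s_coord e (\<gamma> ** g), HQ_part e (\<gamma> ** g)))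
    (lattice_hits (flow_box e D A) g) (hits e F W (coset g) A D)"
    (is "bij_betw ?f ?\<Gamma> ?hits")
  unfolding bij_betw_def
proof (intro conjI equalityI subsetI)
  show "inj_on ?f ?\<Gamma>"
    by (rule inj_on_inverseI[of _ "\<lambda>(s, d). d ** Umat e (- s) ** matrix_inv g"])
      (simp add: HQ_part_mult_Umat g)
next
  fix z assume "z \<in> ?f ` ?\<Gamma>"
  then obtain \<gamma> where \<gamma>: "\<gamma> \<in> Gamma" "\<gamma> ** g \<in> flow_box e D A" "z = ?f \<gamma>"
    by (auto simp: lattice_hits_def)
  have "HQ_part e (\<gamma> ** g) = \<gamma> ** (g ** Umat e (s_coord e (\<gamma> ** g)))"
    by (simp add: HQ_part_def matrix_mul_assoc)
  then have "coset (HQ_part e (\<gamma> ** g)) = coset (g ** Umat e (s_coord e (\<gamma> ** g)))"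
    using \<gamma>(1) coset_eq_iff by blast
  then show "z \<in> ?hits"
    using \<gamma>(2,3) D by (auto simp: hits_def flow_box_iff[OF D(2)])
next
  fix z assume "z \<in> ?hits"
  then obtain s d where z: "z = (s, d)" "coset d = coset (g ** Umat e s)" "s \<in> A" "d \<in> D"
    by (auto simp: hits_def)
  then obtain \<gamma> where \<gamma>: "\<gamma> \<in> Gamma" "d = \<gamma> ** (g ** Umat e s)"
    by (auto simp: coset_eq_iff)
  then have \<gamma>g: "\<gamma> ** g = d ** Umat e (- s)"
    by (simp add: matrix_mul_assoc)
  have "d \<in> HQ e"
    using z(4) D(2) by blast
  then have "z = ?f \<gamma>"
    by (simp add: \<gamma>g z(1) s_coord_HQ_mult_Umat HQ_part_HQ_mult_Umat)
  moreover have "\<gamma> \<in> ?\<Gamma>"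
    using \<gamma>(1) \<gamma>g z(3,4) by (auto simp: lattice_hits_def flow_box_def)
  ultimately show "z \<in> ?f ` ?\<Gamma>" by blast
qed

lemma hits_event_eq_count_event:
  fixes D :: "nat \<Rightarrow> ('k::finite, 'j::finite) mat set"
  assumes D: "(\<Union>i<r. D i) \<subseteq> Sigma1 e F W" and Sigma1: "Sigma1 e F W \<subseteq> HQ e"
  shows "{x \<in> Xsp. \<forall>i<r. finite (hits e F W x (A i) (D i)) \<and> card (hits e F W x (A i) (D i)) = N i}
    = count_event r (\<lambda>i. flow_box e (D i) (A i)) N" (is "?E = ?C")
proof -
  have "coset g \<in> ?E \<longleftrightarrow> coset g \<in> ?C" if g: "det g = 1" for g
  proof -
    have D_sub: "D i \<subseteq> Sigma1 e F W" "D i \<subseteq> HQ e" if "i < r" for i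
      using that D Sigma1 by blast+
    note bij = bij_betw_lattice_hits_hits[OF g D_sub]
    have "finite (lattice_hits (flow_box e (D i) (A i)) g) \<longleftrightarrow> finite (hits e F W (coset g) (A i) (D i))"
      "card (lattice_hits (flow_box e (D i) (A i)) g) = card (hits e F W (coset g) (A i) (D i))"
      if "i < r" for i
      using that by (simp_all add: bij_betw_finite[OF bij] bij_betw_same_card[OF bij])
    then show ?thesis
      using g by (simp add: coset_in_count_event_iff coset_in_Xsp)
  qed
  then show ?thesis
    using count_event_subset_Xsp[of r "\<lambda>i. flow_box e (D i) (A i)" N] by (blast elim: XspE)
qed

lemma hits_L_event_eq_phi_image:
  fixes D :: "nat \<Rightarrow> ('k::finite, 'j::finite) mat set"
  shows "{x \<in> Xsp. \<forall>i<r. finite (hits_L e F W L x (A i) (D i)) \<and> card (hits_L e F W L x (A i) (D i)) = N i}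
    = phi e (ln L / real CARD('k))
        ` {x \<in> Xsp. \<forall>i<r. finite (hits e F W x (A i) (D i)) \<and> card (hits e F W x (A i) (D i)) = N i}"
  by (subst phi_image) (auto simp: hits_L_def phi_def Xact_in_Xsp)

lemma admissible_phi_ln:
  fixes mu lam :: "('k::finite, 'j::finite) mat set measure"
  assumes lam: "admissible e mu lam" and E: "E \<in> sets Xborel" "Xbd E \<in> null_sets mu"
  shows "((\<lambda>L. measure lam (phi e (ln L / real CARD('k)) ` E)) \<longlongrightarrow> measure mu E) at_top"
proof (rule filterlim_compose[of "\<lambda>t. measure lam (phi e t ` E)"])
  show "((\<lambda>t. measure lam (phi e t ` E)) \<longlongrightarrow> measure mu E) at_top"
    using assms by (simp add: admissible_def measure_def null_setsD1)
  show "filterlim (\<lambda>L. ln L / real CARD('k)) at_top at_top"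
    using filterlim_tendsto_pos_mult_at_top[OF tendsto_const _ ln_at_top, of "1 / real CARD('k)"] by simp
qed

theorem theorem3:
  fixes e :: "'j::finite"
    and F :: "('k::finite, 'j) mat set"
    and W :: "(real ^ 'j) set"
    and mu lam :: "('k, 'j) mat set measure"
    and MH :: "('k, 'j) mat measure"
    and r :: nat
    and A :: "nat \<Rightarrow> (real ^ 'k) set"
    and D :: "nat \<Rightarrow> ('k, 'j) mat set"
    and N :: "nat \<Rightarrow> nat"
  assumes mu: "haar_X mu"
    and lam: "admissible e mu lam"
    and MH: "haar_H e MH"
    and F: "fund_dom_H e F"
    and W_sub: "W \<subseteq> Wpos e" and W_bdd: "bounded W" and W_borel: "W \<in> sets borel"
    and W_int: "interior W \<noteq> {}" and W_bd: "frontier W \<in> null_sets lborel"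
    and A_borel: "\<And>i. i < r \<Longrightarrow> A i \<in> sets borel"
    and A_bdd: "\<And>i. i < r \<Longrightarrow> bounded (A i)"
    and A_bd: "\<And>i. i < r \<Longrightarrow> frontier (A i) \<in> null_sets lborel"
    and D_sub: "\<And>i. i < r \<Longrightarrow> D i \<subseteq> Sigma1 e F W"
    and D_borel: "\<And>i. i < r \<Longrightarrow> D i \<in> sets borel"
    and D_cpt: "\<And>i. i < r \<Longrightarrow> compact (top_of_set (HQ e) closure_of D i)"
    and D_bd: "\<And>i. i < r \<Longrightarrow> nu_null e MH (top_of_set (HQ e) frontier_of D i)"
  shows "((\<lambda>L. measure lam {x \<in> Xsp. \<forall>i<r.
              finite (hits_L e F W L x (A i) (D i)) \<and> card (hits_L e F W L x (A i) (D i)) = N i})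
          \<longlongrightarrow> measure mu {x \<in> Xsp. \<forall>i<r.
              finite (hits e F W x (A i) (D i)) \<and> card (hits e F W x (A i) (D i)) = N i}) at_top
         \<and> measure mu {x \<in> Xsp. \<forall>i<r.
              finite (hits e F W x (A i) (D i)) \<and> card (hits e F W x (A i) (D i)) = N i}
           = measure mu {coset g | g. g \<in> SLn \<and> (\<forall>i<r.
              finite {gam \<in> Gamma. gam ** g \<in> {d ** Umat e (- a) | d a. d \<in> D i \<and> a \<in> A i}}
              \<and> card {gam \<in> Gamma. gam ** g \<in> {d ** Umat e (- a) | d a. d \<in> D i \<and> a \<in> A i}} = N i)}"
proof -
  let ?B = "\<lambda>i. flow_box e (D i) (A i)"
  have Sigma1: "Sigma1 e F W \<subseteq> HQ e"
    by (rule Sigma1_subset_HQ[OF F W_sub])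
  have D_Sigma1: "(\<Union>i<r. D i) \<subseteq> Sigma1 e F W"
    using D_sub by blast
  then have D_HQ: "D i \<subseteq> HQ e" if "i < r" for i
    using Sigma1 that by blast
  have "count_event r ?B N \<in> sets Xborel"
    by (intro sets_count_event borel_flow_box D_HQ D_borel A_borel)
  moreover have "Xbd (count_event r ?B N) \<in> null_sets mu"
    by (intro Xbd_count_event_null[OF mu] flow_box_subset_SLn bounded_flow_box
        coset_frontier_flow_box_null[OF mu MH] D_HQ D_cpt D_bd A_bdd A_bd)
  ultimately have "((\<lambda>L. measure lam (phi e (ln L / real CARD('k)) ` count_event r ?B N))
      \<longlongrightarrow> measure mu (count_event r ?B N)) at_top"
    by (rule admissible_phi_ln[OF lam])
  then show ?thesis
    unfolding hits_L_event_eq_phi_image hits_event_eq_count_event[OF D_Sigma1 Sigma1]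
    by (simp add: count_event_def lattice_hits_def flow_box_def)
qed

end
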